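(* Let $\mathbf{x}:U\to\mathbb{R}^3$ be a wavefront with extendable Gaussian curvature. Then, locally at a singularity $p\in\Sigma(\mathbf{x})$ (taking $p$ as the origin of $\mathbb{R}^2$), up to an isometry of $\mathbb{R}^3$, $\mathbf{x}$ is $\mathscr{R}$-equivalent to $$\mathbf{y}(u,v)=\Big(u,\ -h_v(u,v),\ \int_0^u\big(h_u(t,v)-h_{vu}(t,v)\,v\big)\,dt+\int_0^v -h_{vv}(0,t)\,t\,dt\Big),$$ in which $h$ is a smooth function, defined near $(0,0)$, that is a solution of the partial differential equation $$h_{uu}+c(u,v)\,h_{vv}=0,$$ where $c(u,v)$ is a smooth function.
   Context: All maps are $C^\infty$ and $U\subset\mathbb{R}^2$ is open. A map $\mathbf{x}:U\to\mathbb{R}^3$ is a frontal if near each point $p$ there is a smooth unit vector field $\mathbf{n}_p$ orthogonal to $\mathbf{x}_u,\mathbf{x}_v$, and a wavefront if moreover each $(\mathbf{x},\mathbf{n}_p)$ is an immersion into $\mathbb{R}^3\times S^2$. $\Sigma(\mathbf{x})$ is the set of points (singularities) where $\mathbf{x}$ is not immersive. The Gaussian curvature $K$ is defined on $\Sigma(\mathbf{x})^c$ in the usual way, and it is extendable if it has a smooth extension to $U$. Two map germs $\mathbf{f}_1:(U_1,p_1)\to(\mathbb{R}^n,q)$, $\mathbf{f}_2:(U_2,p_2)\to(\mathbb{R}^n,q)$ are $\mathscr{R}$-equivalent if $\mathbf{f}_2=\mathbf{f}_1\circ\mathbf{h}$ for a diffeomorphism germ $\mathbf{h}:(U_2,p_2)\to(U_1,p_1)$.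 "Up to an isometry" means after composing $\mathbf{x}$ on the left with an isometry of $\mathbb{R}^3$.
   Formalization: Extendability of the Gaussian curvature is taken to include that the regular points are dense in U; without this the claim fails, e.g. for (cos u, sin u, 0), a wavefront with no regular points. *)

theory Defs
  imports "HOL-Analysis.Analysis"
begin

text \<open>
  The source plane is modelled by \<open>real \<times> real\<close> and the target space by \<open>real ^ 3\<close>.
  Maps are total in HOL, so every notion takes the open set on which the map is meant
  to be defined as a parameter.
\<close>

primrec Ck_on :: "nat \<Rightarrow> 'a::real_normed_vector set \<Rightarrow> ('a \<Rightarrow> 'b::real_normed_vector) \<Rightarrow> bool" where
  "Ck_on 0 S f \<longleftrightarrow> continuous_on S f"
| "Ck_on (Suc k) S f \<longleftrightarrow>
     (\<forall>a\<in>S. f differentiable (at a)) \<and> (\<forall>w. Ck_on k S (\<lambda>a. frechet_derivative f (at a) w))"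

text \<open>Intended for open \<open>S\<close> only.\<close>
definition smooth_on :: "'a::real_normed_vector set \<Rightarrow> ('a \<Rightarrow> 'b::real_normed_vector) \<Rightarrow> bool" where
  "smooth_on S f \<longleftrightarrow> (\<forall>k. Ck_on k S f)"

definition du :: "(real \<times> real \<Rightarrow> 'b::real_normed_vector) \<Rightarrow> real \<times> real \<Rightarrow> 'b" where
  "du f a = frechet_derivative f (at a) (1, 0)"

definition dv :: "(real \<times> real \<Rightarrow> 'b::real_normed_vector) \<Rightarrow> real \<times> real \<Rightarrow> 'b" where
  "dv f a = frechet_derivative f (at a) (0, 1)"

definition immersive_at :: "('a::real_normed_vector \<Rightarrow> 'b::real_normed_vector) \<Rightarrow> 'a \<Rightarrow> bool" where
  "immersive_at f a \<longleftrightarrow> f differentiable (at a) \<and> inj (frechet_derivative f (at a))"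

definition unit_normal_field ::
    "(real \<times> real) set \<Rightarrow> (real \<times> real \<Rightarrow> real ^ 3) \<Rightarrow> (real \<times> real \<Rightarrow> real ^ 3) \<Rightarrow> bool" where
  "unit_normal_field V x n \<longleftrightarrow> smooth_on V n \<and>
     (\<forall>a\<in>V. norm (n a) = 1 \<and> n a \<bullet> du x a = 0 \<and> n a \<bullet> dv x a = 0)"

definition frontal :: "(real \<times> real) set \<Rightarrow> (real \<times> real \<Rightarrow> real ^ 3) \<Rightarrow> bool" where
  "frontal U x \<longleftrightarrow> smooth_on U x \<and>
     (\<forall>p\<in>U. \<exists>V n. open V \<and> p \<in> V \<and> V \<subseteq> U \<and> unit_normal_field V x n)"

text \<open>
  Since \<open>n\<close> takes values in the unit sphere, an embedded submanifold of \<open>real ^ 3\<close>,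
  \<open>(x, n)\<close> is an immersion into the product of \<open>real ^ 3\<close> and the sphere exactly when its
  differential as a map into \<open>real ^ 3 \<times> real ^ 3\<close> is injective.
\<close>
definition wavefront :: "(real \<times> real) set \<Rightarrow> (real \<times> real \<Rightarrow> real ^ 3) \<Rightarrow> bool" where
  "wavefront U x \<longleftrightarrow> frontal U x \<and>
     (\<forall>p\<in>U. \<exists>V n. open V \<and> p \<in> V \<and> V \<subseteq> U \<and> unit_normal_field V x n \<and>
        (\<forall>a\<in>V. immersive_at (\<lambda>b. (x b, n b)) a))"

definition singular_set :: "(real \<times> real) set \<Rightarrow> (real \<times> real \<Rightarrow> real ^ 3) \<Rightarrow> (real \<times> real) set" where
  "singular_set U x = {a \<in> U. \<not> immersive_at x a}"

text \<open>Meaningful at regular points only (at singular points the cross product vanishes).\<close>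
definition gauss_curvature :: "(real \<times> real \<Rightarrow> real ^ 3) \<Rightarrow> real \<times> real \<Rightarrow> real" where
  "gauss_curvature x a =
     (let N = cross3 (du x a) (dv x a) /\<^sub>R norm (cross3 (du x a) (dv x a));
          E = du x a \<bullet> du x a; F = du x a \<bullet> dv x a; G = dv x a \<bullet> dv x a;
          L = du (du x) a \<bullet> N; M = du (dv x) a \<bullet> N; P = dv (dv x) a \<bullet> N
      in (L * P - M\<^sup>2) / (E * G - F\<^sup>2))"

text \<open>
  An extension of the curvature from the regular points to \<open>U\<close> is understood as an extension
  from a dense subset, hence the first conjunct (\<open>x\<close> is \<open>proper\<close>: its singular set has empty
  interior). Without it the condition would be vacuous on open sets of singularities, and for
  instance \<open>(u, v) \<mapsto> (cos u, sin u, 0)\<close>, a wavefront with unit normal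
  \<open>(cos v * cos u, cos v * sin u, sin v)\<close> and no regular point at all, would count as having
  extendable curvature.
\<close>
definition extendable_gauss_curvature ::
    "(real \<times> real) set \<Rightarrow> (real \<times> real \<Rightarrow> real ^ 3) \<Rightarrow> bool" where
  "extendable_gauss_curvature U x \<longleftrightarrow> U \<subseteq> closure (U - singular_set U x) \<and>
     (\<exists>K :: real \<times> real \<Rightarrow> real. smooth_on U K \<and>
        (\<forall>a \<in> U - singular_set U x. K a = gauss_curvature x a))"

definition diffeo_between ::
    "'a::real_normed_vector set \<Rightarrow> 'a set \<Rightarrow> ('a \<Rightarrow> 'a) \<Rightarrow> bool" where
  "diffeo_between V W \<phi> \<longleftrightarrow> bij_betw \<phi> V W \<and> smooth_on V \<phi> \<and> smooth_on W (inv_into V \<phi>)"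

text \<open>
  The germ at \<open>p1\<close> of \<open>f1\<close>, defined on \<open>U1\<close>, and the germ at \<open>p2\<close> of \<open>f2\<close>, defined on \<open>U2\<close>,
  are R-equivalent.
\<close>
definition R_equivalent ::
    "('a::real_normed_vector \<Rightarrow> 'b) \<Rightarrow> 'a set \<Rightarrow> 'a \<Rightarrow> ('a \<Rightarrow> 'b) \<Rightarrow> 'a set \<Rightarrow> 'a \<Rightarrow> bool" where
  "R_equivalent f1 U1 p1 f2 U2 p2 \<longleftrightarrow>
     (\<exists>V1 V2 \<phi>. open V1 \<and> p1 \<in> V1 \<and> V1 \<subseteq> U1 \<and> open V2 \<and> p2 \<in> V2 \<and> V2 \<subseteq> U2 \<and>
        diffeo_between V2 V1 \<phi> \<and> \<phi> p2 = p1 \<and> (\<forall>a\<in>V2. f2 a = f1 (\<phi> a)))"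

text \<open>
  The interval integrals are oriented, so negative \<open>u\<close> and \<open>v\<close> are covered. If \<open>h\<close> is smooth on
  a disc about the origin and \<open>(u, v)\<close> lies in it, so do both segments of integration.
\<close>
definition normal_form :: "(real \<times> real \<Rightarrow> real) \<Rightarrow> real \<times> real \<Rightarrow> real ^ 3" where
  "normal_form h = (\<lambda>(u, v). vector
     [u,
      - dv h (u, v),
      (LBINT t=0..u. du h (t, v) - du (dv h) (t, v) * v) +
      (LBINT t=0..v. - dv (dv h) (0, t) * t)])"

end

theory Submission
  imports Defs
begin

text \<open>
  At a singularity \<open>p\<close> the differential of \<open>x\<close> has rank exactly 1. Indeed, for a smooth unit normal \<open>n\<close>,
  \<open>n\<^sub>u \<times> n\<^sub>v = K (x\<^sub>u \<times> x\<^sub>v)\<close> holds at regular points, hence everywhere by density when \<open>K\<close> extends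
  (\<open>cross_D_normal_extended\<close>); rank 0 would then make \<open>D n p\<close> degenerate and \<open>(x, n)\<close> could
  not be immersive.

  Choose an orthonormal frame with \<open>e\<^sub>3 = n p\<close> and \<open>e\<^sub>1\<close> spanning the image of \<open>D x p\<close>, and write
  \<open>x\<^sub>i\<close>, \<open>n\<^sub>i\<close> for the coordinates of \<open>x - x p\<close> and \<open>n\<close> in it. Where \<open>x\<close> is a graph over the
  \<open>(x\<^sub>1, x\<^sub>2)\<close>-plane, the slope of \<open>x\<^sub>3\<close> in the direction \<open>x\<^sub>2\<close> is \<open>- n\<^sub>2 / n\<^sub>3\<close>. At a
  singularity this slope is no longer a function of a graph, but it is still smooth, and
  \<open>u = x\<^sub>1\<close>, \<open>v = - n\<^sub>2 / n\<^sub>3\<close> are local coordinates at \<open>p\<close> (\<open>adapted_coordinates\<close>): this is where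
  the immersivity of \<open>(x, n)\<close> and the symmetry of the second fundamental form enter.

  In these coordinates orthogonality to \<open>n\<close> reads \<open>dx\<^sub>3 = - (n\<^sub>1 / n\<^sub>3) du + v dx\<^sub>2\<close>, so the partial Legendre
  transform \<open>h = x\<^sub>3 - v x\<^sub>2\<close> has \<open>h\<^sub>u = - n\<^sub>1 / n\<^sub>3\<close> and \<open>h\<^sub>v = - x\<^sub>2\<close>, and conversely
  \<open>x\<^sub>3 = h - v h\<^sub>v\<close>, which is the value of the integrals in the normal form
  (\<open>normal_form_eq_Legendre_transform\<close>). Finally, \<open>h\<^sub>u\<^sub>u\<close> is the Jacobian of \<open>(n\<^sub>1 / n\<^sub>3, n\<^sub>2 / n\<^sub>3)\<close>, which is
  \<open>1 / n\<^sub>3\<^sup>4\<close> times that of \<open>(n\<^sub>1, n\<^sub>2)\<close>, and \<open>- h\<^sub>v\<^sub>v\<close> is the Jacobian of \<open>(x\<^sub>1, x\<^sub>2)\<close>. The relation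
  between the cross products thus becomes the differential equation, with \<open>c = K / n\<^sub>3\<^sup>4\<close>
  (\<open>partial_Legendre_transform\<close>).
\<close>

section \<open>Calculus of smooth maps\<close>

abbreviation D :: "('a::real_normed_vector \<Rightarrow> 'b::real_normed_vector) \<Rightarrow> 'a \<Rightarrow> 'a \<Rightarrow> 'b" where
  "D f a \<equiv> frechet_derivative f (at a)"

lemma D_eqI: "(f has_derivative f') (at a) \<Longrightarrow> D f a w = f' w"
  using frechet_derivative_at by metis

lemma D_cong:
  assumes "open S" "a \<in> S" "\<And>b. b \<in> S \<Longrightarrow> f b = g b" "f differentiable (at a)"
  shows "D g a w = D f a w"
  using frechet_derivative_transform_within_open[OF assms(4,1,2,3)] by simp

lemma Ck_on_cong:
  assumes "open S" "\<And>a. a \<in> S \<Longrightarrow> f a = g a" "Ck_on k S f"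
  shows "Ck_on k S g"
  using assms(2,3)
proof (induction k arbitrary: f g)
  case 0
  then show ?case by (metis Ck_on.simps(1) continuous_on_cong)
next
  case (Suc k)
  have g': "(g has_derivative D f a) (at a)" if "a \<in> S" for a
  proof (rule has_derivative_transform_within_open[OF _ \<open>open S\<close> that])
    show "(f has_derivative D f a) (at a)"
      using Suc.prems(2) that by (simp add: frechet_derivative_works)
  qed (use Suc.prems in auto)
  have "Ck_on k S (\<lambda>a. D g a w)" for w
    by (rule Suc.IH[of "\<lambda>a. D f a w"]) (use Suc.prems D_eqI[OF g'] in auto)
  then show ?case using g' by (auto simp: differentiable_def)
qed

lemma Ck_on_Suc_intro:
  assumes "\<And>a. a \<in> S \<Longrightarrow> (f has_derivative f' a) (at a)"
    and "\<And>w. Ck_on k S (\<lambda>a. f' a w)" and "open S"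
  shows "Ck_on (Suc k) S f"
proof -
  have "Ck_on k S (\<lambda>a. D f a w)" for w
    by (rule Ck_on_cong[OF \<open>open S\<close> _ assms(2)[of w]]) (simp add: D_eqI[OF assms(1)])
  then show ?thesis
    using assms(1) by (auto simp: differentiable_def)
qed

lemma Ck_on_Suc_imp:
  "Ck_on (Suc k) S f \<Longrightarrow> Ck_on k S f"
proof (induction k arbitrary: f)
  case 0
  then show ?case
    by (auto intro!: continuous_at_imp_continuous_on differentiable_imp_continuous_within)
next
  case (Suc k)
  then show ?case by (metis Ck_on.simps(2))
qed

lemma Ck_on_subset: "Ck_on k S f \<Longrightarrow> T \<subseteq> S \<Longrightarrow> Ck_on k T f"
  by (induction k arbitrary: f) (auto intro: continuous_on_subset)

lemma Ck_on_has_derivative: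
  "Ck_on (Suc k) S f \<Longrightarrow> a \<in> S \<Longrightarrow> (f has_derivative D f a) (at a)"
  by (simp add: frechet_derivative_works)

lemma Ck_on_const: "Ck_on k S (\<lambda>_. c)"
  by (induction k arbitrary: c) auto

lemma Ck_on_bounded_linear:
  assumes "open S" "bounded_linear L"
  shows "Ck_on k S f \<Longrightarrow> Ck_on k S (\<lambda>a. L (f a))"
proof (induction k arbitrary: f)
  case 0
  then show ?case using assms by (simp add: bounded_linear.continuous_on)
next
  case (Suc k)
  show ?case
  proof (rule Ck_on_Suc_intro[OF _ _ assms(1)])
    show "((\<lambda>a. L (f a)) has_derivative (\<lambda>w. L (D f a w))) (at a)" if "a \<in> S" for a
      using Ck_on_has_derivative[OF Suc.prems that] bounded_linear.has_derivative[OF assms(2)]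
      by blast
  qed (use Suc in auto)
qed

lemma Ck_on_add:
  assumes "open S"
  shows "Ck_on k S f \<Longrightarrow> Ck_on k S g \<Longrightarrow> Ck_on k S (\<lambda>a. f a + g a)"
proof (induction k arbitrary: f g)
  case 0
  then show ?case by (simp add: continuous_on_add)
next
  case (Suc k)
  show ?case
  proof (rule Ck_on_Suc_intro[OF _ _ assms])
    show "((\<lambda>a. f a + g a) has_derivative (\<lambda>w. D f a w + D g a w)) (at a)" if "a \<in> S" for a
      using Ck_on_has_derivative[OF Suc.prems(1) that] Ck_on_has_derivative[OF Suc.prems(2) that]
      by (rule has_derivative_add)
  qed (use Suc in auto)
qed

lemma Ck_on_bilinear:
  assumes "open S" "bounded_bilinear B"
  shows "Ck_on k S f \<Longrightarrow> Ck_on k S g \<Longrightarrow> Ck_on k S (\<lambda>a. B (f a) (g a))"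
proof (induction k arbitrary: f g)
  case 0
  then show ?case using bounded_bilinear.continuous_on[OF assms(2)] by simp
next
  case (Suc k)
  show ?case
  proof (rule Ck_on_Suc_intro[OF _ _ assms(1)])
    show "((\<lambda>a. B (f a) (g a)) has_derivative (\<lambda>w. B (f a) (D g a w) + B (D f a w) (g a))) (at a)"
      if "a \<in> S" for a
      using bounded_bilinear.FDERIV[OF assms(2) Ck_on_has_derivative[OF Suc.prems(1) that]
          Ck_on_has_derivative[OF Suc.prems(2) that]] .
    show "Ck_on k S (\<lambda>a. B (f a) (D g a w) + B (D f a w) (g a))" for w
      using Suc.prems[THEN Ck_on_Suc_imp] Suc.prems
      by (intro Ck_on_add assms Suc.IH) auto
  qed
qed

lemma Ck_on_inverse:
  fixes f :: "'a::real_normed_vector \<Rightarrow> real"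
  assumes "open S" "\<And>a. a \<in> S \<Longrightarrow> f a \<noteq> 0"
  shows "Ck_on k S f \<Longrightarrow> Ck_on k S (\<lambda>a. inverse (f a))"
proof (induction k)
  case 0
  then show ?case using assms by (simp add: continuous_on_inverse)
next
  case (Suc k)
  note mult = Ck_on_bilinear[OF assms(1) bounded_bilinear_mult]
  show ?case
  proof (rule Ck_on_Suc_intro[OF _ _ assms(1)])
    show "((\<lambda>a. inverse (f a)) has_derivative
        (\<lambda>w. (-1) * (D f a w * (inverse (f a) * inverse (f a))))) (at a)" if "a \<in> S" for a
      using Deriv.has_derivative_inverse[OF assms(2)[OF that] Ck_on_has_derivative[OF Suc.prems that]]
      by (simp add: algebra_simps)
    show "Ck_on k S (\<lambda>a. (-1) * (D f a w * (inverse (f a) * inverse (f a))))" for w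
      using Suc.IH[OF Ck_on_Suc_imp[OF Suc.prems]] Suc.prems
      by (intro mult Ck_on_const) auto
  qed
qed

lemma Ck_on_sum:
  assumes "open S" "finite I" "\<And>i. i \<in> I \<Longrightarrow> Ck_on k S (f i)"
  shows "Ck_on k S (\<lambda>a. \<Sum>i\<in>I. f i a)"
  using assms(2,3) by (induction I) (auto intro: Ck_on_const Ck_on_add[OF assms(1)])

text \<open>
  The chain rule expands the outer derivative in a basis, \<open>D g (f a) (D f a w)\<close> being the sum of
  the coordinates of \<open>D f a w\<close> times the partial derivatives of \<open>g\<close> at \<open>f a\<close>. The former are of
  class \<open>k\<close> by assumption, the latter by the induction hypothesis.
\<close>
lemma Ck_on_compose:
  fixes f :: "'a::real_normed_vector \<Rightarrow> 'b::euclidean_space"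
  assumes "open S" "open T" "f ` S \<subseteq> T"
  shows "Ck_on k T g \<Longrightarrow> Ck_on k S f \<Longrightarrow> Ck_on k S (\<lambda>a. g (f a))"
proof (induction k arbitrary: g)
  case 0
  then show ?case using assms continuous_on_compose2 by fastforce
next
  case (Suc k)
  show ?case
  proof (rule Ck_on_Suc_intro[OF _ _ assms(1)])
    fix a assume a: "a \<in> S"
    then have "f a \<in> T" using assms by auto
    note g' = Ck_on_has_derivative[OF Suc.prems(1) this]
    have "linear (D g (f a))" using g' has_derivative_linear by blast
    then have basis: "D g (f a) u = (\<Sum>i\<in>Basis. (u \<bullet> i) *\<^sub>R D g (f a) i)" for u
      using linear_sum[of "D g (f a)" "\<lambda>i. (u \<bullet> i) *\<^sub>R i" Basis]
      by (simp add: euclidean_representation linear_cmul)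
    show "((\<lambda>a. g (f a)) has_derivative
        (\<lambda>w. \<Sum>i\<in>Basis. (D f a w \<bullet> i) *\<^sub>R D g (f a) i)) (at a)"
      using has_derivative_compose[OF Ck_on_has_derivative[OF Suc.prems(2) a] g']
      unfolding basis[of "D f a _", abs_def] .
  next
    fix w
    show "Ck_on k S (\<lambda>a. \<Sum>i\<in>Basis. (D f a w \<bullet> i) *\<^sub>R D g (f a) i)"
      using Suc.prems Suc.IH Ck_on_Suc_imp[OF Suc.prems(2)]
      by (intro Ck_on_sum Ck_on_bilinear[OF _ bounded_bilinear_scaleR] assms(1)
          Ck_on_bounded_linear[OF _ bounded_linear_inner_left]) auto
  qed
qed

lemma smooth_on_cong:
  "open S \<Longrightarrow> smooth_on S f \<Longrightarrow> (\<And>a. a \<in> S \<Longrightarrow> f a = g a) \<Longrightarrow> smooth_on S g"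
  unfolding smooth_on_def using Ck_on_cong by metis

lemma smooth_on_subset: "smooth_on S f \<Longrightarrow> T \<subseteq> S \<Longrightarrow> smooth_on T f"
  unfolding smooth_on_def using Ck_on_subset by blast

lemma smooth_on_has_derivative:
  "smooth_on S f \<Longrightarrow> a \<in> S \<Longrightarrow> (f has_derivative D f a) (at a)"
  unfolding smooth_on_def using Ck_on_has_derivative by blast

lemma smooth_on_differentiable: "smooth_on S f \<Longrightarrow> a \<in> S \<Longrightarrow> f differentiable (at a)"
  using smooth_on_has_derivative frechet_derivative_works by blast

lemma smooth_on_D: "smooth_on S f \<Longrightarrow> smooth_on S (\<lambda>a. D f a w)"
  unfolding smooth_on_def by (metis Ck_on.simps(2))

lemma smooth_on_du: "smooth_on S f \<Longrightarrow> smooth_on S (du f)"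
  and smooth_on_dv: "smooth_on S f \<Longrightarrow> smooth_on S (dv f)"
  using smooth_on_D unfolding du_def[abs_def] dv_def[abs_def] by blast+

lemma smooth_on_continuous: "smooth_on S f \<Longrightarrow> continuous_on S f"
  unfolding smooth_on_def using Ck_on.simps(1) by blast

lemma smooth_on_const: "smooth_on S (\<lambda>_. c)"
  by (simp add: smooth_on_def Ck_on_const)

lemma smooth_on_bounded_linear:
  "open S \<Longrightarrow> bounded_linear L \<Longrightarrow> smooth_on S f \<Longrightarrow> smooth_on S (\<lambda>a. L (f a))"
  by (simp add: smooth_on_def Ck_on_bounded_linear)

lemma smooth_on_ident: "smooth_on S (\<lambda>a. a)"
proof -
  have "Ck_on k S (\<lambda>a. a)" for k
    by (cases k) (auto simp: Ck_on_const)
  then show ?thesis by (simp add: smooth_on_def)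
qed

lemma smooth_on_add:
  "open S \<Longrightarrow> smooth_on S f \<Longrightarrow> smooth_on S g \<Longrightarrow> smooth_on S (\<lambda>a. f a + g a)"
  by (simp add: smooth_on_def Ck_on_add)

lemma smooth_on_minus: "open S \<Longrightarrow> smooth_on S f \<Longrightarrow> smooth_on S (\<lambda>a. - f a)"
  using smooth_on_bounded_linear[OF _ bounded_linear_minus[OF bounded_linear_ident]] by blast

lemma smooth_on_diff:
  "open S \<Longrightarrow> smooth_on S f \<Longrightarrow> smooth_on S g \<Longrightarrow> smooth_on S (\<lambda>a. f a - g a)"
  using smooth_on_add[of S f "\<lambda>a. - g a"] smooth_on_minus[of S g] by simp

lemma smooth_on_mult:
  fixes f g :: "'a::real_normed_vector \<Rightarrow> real"
  shows "open S \<Longrightarrow> smooth_on S f \<Longrightarrow> smooth_on S g \<Longrightarrow> smooth_on S (\<lambda>a. f a * g a)"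
  by (simp add: smooth_on_def Ck_on_bilinear bounded_bilinear_mult)

lemma smooth_on_divide:
  fixes f g :: "'a::real_normed_vector \<Rightarrow> real"
  assumes "open S" "smooth_on S f" "smooth_on S g" "\<And>a. a \<in> S \<Longrightarrow> g a \<noteq> 0"
  shows "smooth_on S (\<lambda>a. f a / g a)"
proof -
  have "smooth_on S (\<lambda>a. inverse (g a))"
    using assms by (simp add: smooth_on_def Ck_on_inverse)
  then show ?thesis
    using smooth_on_mult[OF assms(1,2)] by (simp add: divide_inverse)
qed

lemma smooth_on_power:
  fixes f :: "'a::real_normed_vector \<Rightarrow> real"
  shows "open S \<Longrightarrow> smooth_on S f \<Longrightarrow> smooth_on S (\<lambda>a. f a ^ m)"
  by (induction m) (auto intro: smooth_on_mult smooth_on_const)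

lemma smooth_on_inner_left:
  "open S \<Longrightarrow> smooth_on S f \<Longrightarrow> smooth_on S (\<lambda>a. f a \<bullet> e)"
  using smooth_on_bounded_linear[OF _ bounded_linear_inner_left] by blast

lemma Ck_on_Pair:
  assumes "open S" "Ck_on k S f" "Ck_on k S g"
  shows "Ck_on k S (\<lambda>a. (f a, g a))"
  using Ck_on_add[OF assms(1) 
      Ck_on_bounded_linear[OF assms(1) bounded_linear_Pair[OF bounded_linear_ident bounded_linear_zero] assms(2)]
      Ck_on_bounded_linear[OF assms(1) bounded_linear_Pair[OF bounded_linear_zero bounded_linear_ident] assms(3)]]
  by simp

lemma smooth_on_Pair:
  "open S \<Longrightarrow> smooth_on S f \<Longrightarrow> smooth_on S g \<Longrightarrow> smooth_on S (\<lambda>a. (f a, g a))"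
  by (simp add: smooth_on_def Ck_on_Pair)

lemma smooth_on_compose:
  fixes f :: "'a::real_normed_vector \<Rightarrow> 'b::euclidean_space"
  assumes "open S" "open T" "f ` S \<subseteq> T" "smooth_on T g" "smooth_on S f"
  shows "smooth_on S (\<lambda>a. g (f a))"
  using assms unfolding smooth_on_def by (metis Ck_on_compose)

section \<open>Symmetry of second derivatives\<close>

lemma D_along_line:
  fixes f :: "'a::real_normed_vector \<Rightarrow> real"
  assumes "f differentiable (at (b + t *\<^sub>R w))"
  shows "((\<lambda>t. f (b + t *\<^sub>R w)) has_real_derivative D f (b + t *\<^sub>R w) w) (at t)"
proof -
  have "linear (D f (b + t *\<^sub>R w))"
    using assms by (rule linear_frechet_derivative)
  then have "D f (b + t *\<^sub>R w) (s *\<^sub>R w) = D f (b + t *\<^sub>R w) w * s" for s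
    by (simp add: linear_cmul mult.commute)
  moreover have "((\<lambda>t. b + t *\<^sub>R w) has_derivative (\<lambda>s. s *\<^sub>R w)) (at t)"
    by (auto intro!: derivative_eq_intros)
  from has_derivative_compose[OF this assms[unfolded frechet_derivative_works]]
  have "((\<lambda>t. f (b + t *\<^sub>R w)) has_derivative (\<lambda>s. D f (b + t *\<^sub>R w) (s *\<^sub>R w))) (at t)" .
  ultimately show ?thesis
    by (simp add: has_field_derivative_def)
qed

text \<open>
  The second difference of \<open>f\<close> over a small parallelogram is, by two applications of the mean
  value theorem, a mixed second derivative at a nearby point. It is symmetric in the two sides of
  the parallelogram, which is why mixed derivatives commute.
\<close>
lemma second_difference_mean_value:
  fixes f :: "'a::real_normed_vector \<Rightarrow> real"
  assumes "smooth_on (ball a e) f" "0 < s" "s * (norm w + norm z) < e"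
  obtains b where "dist a b \<le> s * (norm w + norm z)"
    "f (a + s *\<^sub>R w + s *\<^sub>R z) - f (a + s *\<^sub>R w) - f (a + s *\<^sub>R z) + f a
       = s\<^sup>2 * D (\<lambda>b. D f b w) b z"
proof -
  have near: "dist a (a + t *\<^sub>R w + r *\<^sub>R z) \<le> s * (norm w + norm z)"
    if "0 \<le> t" "t \<le> s" "0 \<le> r" "r \<le> s" for t r
  proof -
    have "dist a (a + t *\<^sub>R w + r *\<^sub>R z) = norm (t *\<^sub>R w + r *\<^sub>R z)"
      by (metis add.assoc dist_add_cancel dist_0_norm add.right_neutral)
    also have "\<dots> \<le> t * norm w + r * norm z"
      using norm_triangle_ineq[of "t *\<^sub>R w" "r *\<^sub>R z"] that by simp
    also have "\<dots> \<le> s * norm w + s * norm z"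
      using that by (intro add_mono mult_right_mono) auto
    finally show ?thesis by (simp add: distrib_left)
  qed
  then have inside: "a + t *\<^sub>R w + r *\<^sub>R z \<in> ball a e"
    if "0 \<le> t" "t \<le> s" "0 \<le> r" "r \<le> s" for t r
    using that assms(3) by (meson mem_ball order_le_less_trans)
  have diff_f: "f differentiable (at b)" if "b \<in> ball a e" for b
    using smooth_on_differentiable[OF assms(1) that] .
  have "\<exists>t>0. t < s \<and> (f (a + s *\<^sub>R z + s *\<^sub>R w) - f (a + s *\<^sub>R w))
      - (f (a + s *\<^sub>R z + 0 *\<^sub>R w) - f (a + 0 *\<^sub>R w))
      = (s - 0) * (D f (a + s *\<^sub>R z + t *\<^sub>R w) w - D f (a + t *\<^sub>R w) w)"
  proof (rule MVT2[OF \<open>0 < s\<close>])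
    fix t assume t: "0 \<le> t" "t \<le> s"
    have "a + s *\<^sub>R z + t *\<^sub>R w \<in> ball a e" "a + t *\<^sub>R w \<in> ball a e"
      using inside[of t s] inside[of t 0] t by (auto simp: algebra_simps)
    then show "((\<lambda>t. f (a + s *\<^sub>R z + t *\<^sub>R w) - f (a + t *\<^sub>R w)) has_real_derivative
        D f (a + s *\<^sub>R z + t *\<^sub>R w) w - D f (a + t *\<^sub>R w) w) (at t)"
      by (intro DERIV_diff D_along_line diff_f)
  qed
  then obtain t where t: "0 < t" "t < s" and diff_t:
    "(f (a + s *\<^sub>R z + s *\<^sub>R w) - f (a + s *\<^sub>R w)) - (f (a + s *\<^sub>R z) - f a)
      = s * (D f (a + s *\<^sub>R z + t *\<^sub>R w) w - D f (a + t *\<^sub>R w) w)"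
    by auto
  have "\<exists>r>0. r < s \<and> D f (a + t *\<^sub>R w + s *\<^sub>R z) w - D f (a + t *\<^sub>R w + 0 *\<^sub>R z) w
      = (s - 0) * D (\<lambda>b. D f b w) (a + t *\<^sub>R w + r *\<^sub>R z) z"
  proof (rule MVT2[OF \<open>0 < s\<close>])
    fix r assume "0 \<le> r" "r \<le> s"
    then have "a + t *\<^sub>R w + r *\<^sub>R z \<in> ball a e"
      using inside[of t r] t by auto
    then show "((\<lambda>r. D f (a + t *\<^sub>R w + r *\<^sub>R z) w) has_real_derivative
        D (\<lambda>b. D f b w) (a + t *\<^sub>R w + r *\<^sub>R z) z) (at r)"
      by (intro D_along_line smooth_on_differentiable[OF smooth_on_D[OF assms(1)]])
  qed
  then obtain r where r: "0 < r" "r < s" and diff_r: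
    "D f (a + t *\<^sub>R w + s *\<^sub>R z) w - D f (a + t *\<^sub>R w) w
      = s * D (\<lambda>b. D f b w) (a + t *\<^sub>R w + r *\<^sub>R z) z"
    by auto
  show thesis
  proof
    show "dist a (a + t *\<^sub>R w + r *\<^sub>R z) \<le> s * (norm w + norm z)"
      using near t r by simp
    have swap: "a + s *\<^sub>R z + t *\<^sub>R w = a + t *\<^sub>R w + s *\<^sub>R z" for t
      by simp
    show "f (a + s *\<^sub>R w + s *\<^sub>R z) - f (a + s *\<^sub>R w) - f (a + s *\<^sub>R z) + f a
       = s\<^sup>2 * D (\<lambda>b. D f b w) (a + t *\<^sub>R w + r *\<^sub>R z) z"
      using diff_t unfolding swap diff_r power2_eq_square mult.assoc by linarith
  qed
qed

lemma second_D_symmetric_real: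
  fixes f :: "'a::real_normed_vector \<Rightarrow> real"
  assumes "open S" "a \<in> S" "smooth_on S f"
  shows "D (\<lambda>b. D f b w) a z = D (\<lambda>b. D f b z) a w"
proof (rule ccontr)
  define A B where "A b = D (\<lambda>b. D f b w) b z" and "B b = D (\<lambda>b. D f b z) b w" for b
  assume "\<not> ?thesis"
  then have pos: "0 < dist (A a) (B a) / 2"
    by (simp add: A_def B_def)
  obtain e where e: "0 < e" "ball a e \<subseteq> S"
    using assms by (meson open_contains_ball)
  have "continuous_on S A" "continuous_on S B"
    unfolding A_def[abs_def] B_def[abs_def]
    using assms(3) by (intro smooth_on_continuous smooth_on_D; simp)+
  then have "isCont A a" "isCont B a"
    using assms by (simp_all add: continuous_on_eq_continuous_at)
  then obtain d1 d2 where d: "0 < d1" "\<And>b. dist a b < d1 \<Longrightarrow> dist (A a) (A b) < dist (A a) (B a) / 2"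
    "0 < d2" "\<And>b. dist a b < d2 \<Longrightarrow> dist (B a) (B b) < dist (A a) (B a) / 2"
    using pos unfolding continuous_at_eps_delta by (metis dist_commute dist_norm)
  define m where "m = min e (min d1 d2)"
  define s where "s = m / (norm w + norm z + 1)"
  have "0 < m" using e d by (simp add: m_def)
  have "0 < norm w + norm z + 1"
    using norm_ge_zero[of w] norm_ge_zero[of z] by linarith
  then have s: "0 < s" "s * (norm w + norm z) < m"
    using \<open>0 < m\<close> by (simp_all add: s_def field_simps)
  have sm: "smooth_on (ball a e) f"
    using assms(3) e(2) by (rule smooth_on_subset)
  obtain b where b: "dist a b \<le> s * (norm w + norm z)"
    "f (a + s *\<^sub>R w + s *\<^sub>R z) - f (a + s *\<^sub>R w) - f (a + s *\<^sub>R z) + f a = s\<^sup>2 * A b"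
    using second_difference_mean_value[OF sm s(1), of w z] s(2) unfolding A_def m_def by auto
  obtain c where c: "dist a c \<le> s * (norm w + norm z)"
    "f (a + s *\<^sub>R z + s *\<^sub>R w) - f (a + s *\<^sub>R z) - f (a + s *\<^sub>R w) + f a = s\<^sup>2 * B c"
    using second_difference_mean_value[OF sm s(1), of z w] s(2)
    unfolding B_def m_def by (auto simp: add.commute)
  have "s\<^sup>2 * A b = s\<^sup>2 * B c"
    using b(2) c(2) by (simp add: algebra_simps)
  then have "A b = B c"
    using s(1) by simp
  moreover have "dist a b < d1" "dist a c < d2"
    using b(1) c(1) s(2) by (auto simp: m_def)
  then have "dist (A a) (A b) < dist (A a) (B a) / 2" "dist (B a) (B c) < dist (A a) (B a) / 2"
    using d by blast+
  ultimately show False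
    using dist_triangle[of "A a" "B a" "A b"] by (simp add: dist_commute)
qed

lemma D_inner_left:
  "f differentiable (at a) \<Longrightarrow> D (\<lambda>b. f b \<bullet> e) a w = D f a w \<bullet> e"
  using D_eqI[OF has_derivative_inner_left] frechet_derivative_works by blast

text \<open>
  Testing against a fixed vector reduces this to scalar maps.
\<close>
lemma second_D_symmetric:
  fixes f :: "'a::real_normed_vector \<Rightarrow> 'b::real_inner"
  assumes "open S" "a \<in> S" "smooth_on S f"
  shows "D (\<lambda>b. D f b w) a z = D (\<lambda>b. D f b z) a w"
proof (rule vector_eq_rdot[THEN iffD1], rule allI)
  fix e
  note smooth_on_differentiable[OF assms(3)] and smooth_on_D[OF assms(3)]
  note diff = this(1) smooth_on_differentiable[OF this(2)]
  have "D (\<lambda>b. D (\<lambda>c. f c \<bullet> e) b w) a z = D (\<lambda>b. D f b w) a z \<bullet> e" for w z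
  proof -
    have "D (\<lambda>b. D (\<lambda>c. f c \<bullet> e) b w) a z = D (\<lambda>b. D f b w \<bullet> e) a z"
    proof (rule D_cong[OF assms(1,2)])
      show "D f b w \<bullet> e = D (\<lambda>c. f c \<bullet> e) b w" if "b \<in> S" for b
        using D_inner_left[OF diff(1)[OF that]] by simp
      show "(\<lambda>b. D f b w \<bullet> e) differentiable at a"
        using diff(2)[OF assms(2), of w] by (simp add: differentiable_inner)
    qed
    then show ?thesis
      using D_inner_left[OF diff(2)[OF assms(2)]] by simp
  qed
  then show "D (\<lambda>b. D f b w) a z \<bullet> e = D (\<lambda>b. D f b z) a w \<bullet> e"
    using second_D_symmetric_real[OF assms(1,2) smooth_on_inner_left[OF assms(1,3)]] by metis
qed

section \<open>Smooth local inverses in the plane\<close>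

lemma D_prod_eq:
  fixes f :: "real \<times> real \<Rightarrow> 'b::real_normed_vector"
  assumes "f differentiable (at a)"
  shows "D f a w = fst w *\<^sub>R du f a + snd w *\<^sub>R dv f a"
proof -
  interpret linear "D f a"
    using assms by (rule linear_frechet_derivative)
  have "w = fst w *\<^sub>R (1, 0) + snd w *\<^sub>R (0, 1)"
    by (cases w) simp
  then show ?thesis
    by (metis add scaleR du_def dv_def)
qed

lemma immersive_at_iff:
  fixes f :: "'a::real_normed_vector \<Rightarrow> 'b::real_normed_vector"
  assumes "f differentiable (at a)"
  shows "immersive_at f a \<longleftrightarrow> (\<forall>w. D f a w = 0 \<longrightarrow> w = 0)"
  using linear_injective_0[OF linear_frechet_derivative[OF assms]] assms
  by (simp add: immersive_at_def)

text \<open>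
  Cramer's rule expresses the derivative of the inverse as a smooth function of \<open>f\<close>'s partial
  derivatives at \<open>g y\<close>, so each degree of differentiability of \<open>g\<close> yields the next one.
\<close>
lemma smooth_on_inverse:
  fixes f g :: "real \<times> real \<Rightarrow> real \<times> real"
  assumes "open V" "open W" "smooth_on V f" "g ` W \<subseteq> V"
    and der: "\<And>y. y \<in> W \<Longrightarrow> (g has_derivative g' y) (at y)"
    and inv: "\<And>y w. y \<in> W \<Longrightarrow> D f (g y) (g' y w) = w"
  shows "smooth_on W g"
proof -
  (* J is the Jacobian determinant of f; P w b solves D f b z = w for z. *)
  define J where "J b = fst (du f b) * snd (dv f b) - snd (du f b) * fst (dv f b)" for b
  define P where "P w b = ((fst w * snd (dv f b) - snd w * fst (dv f b)) / J b,
      (snd w * fst (du f b) - fst w * snd (du f b)) / J b)" for w b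
  let ?V = "{b \<in> V. J b \<noteq> 0}"
  have sm: "smooth_on V (\<lambda>b. fst (du f b))" "smooth_on V (\<lambda>b. snd (du f b))"
    "smooth_on V (\<lambda>b. fst (dv f b))" "smooth_on V (\<lambda>b. snd (dv f b))"
    using smooth_on_du[OF assms(3)] smooth_on_dv[OF assms(3)]
    by (auto intro: smooth_on_bounded_linear[OF assms(1)] bounded_linear_fst bounded_linear_snd)
  then have J: "smooth_on V J"
    unfolding J_def[abs_def] by (intro smooth_on_diff smooth_on_mult assms(1))
  have "open ?V"
    using continuous_open_preimage[OF smooth_on_continuous[OF J] assms(1), of "- {0}"]
      open_Compl[OF closed_singleton[of "0::real"]]
    by (simp add: vimage_def Int_def)
  have P: "smooth_on ?V (P w)" for w
    unfolding P_def[abs_def]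
    by (intro smooth_on_Pair smooth_on_divide smooth_on_diff smooth_on_mult smooth_on_const \<open>open ?V\<close>
        smooth_on_subset[OF J] smooth_on_subset[OF sm(1)] smooth_on_subset[OF sm(2)]
        smooth_on_subset[OF sm(3)] smooth_on_subset[OF sm(4)]) auto
  have expand: "fst w = fst (g' y w) * fst (du f (g y)) + snd (g' y w) * fst (dv f (g y)) \<and>
      snd w = fst (g' y w) * snd (du f (g y)) + snd (g' y w) * snd (dv f (g y))" if "y \<in> W" for y w
  proof -
    have "g y \<in> V" using assms(4) that by blast
    from D_prod_eq[OF smooth_on_differentiable[OF assms(3) this], of "g' y w"] inv[OF that, of w]
    show ?thesis by (metis fst_add snd_add fst_scaleR snd_scaleR real_scaleR_def)
  qed
  (* The columns g' y (1, 0) and g' y (0, 1) form a right inverse of D f (g y); take determinants. *)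
  have nz: "J (g y) \<noteq> 0" if "y \<in> W" for y
  proof
    assume 0: "J (g y) = 0"
    obtain p q p' q' where pq: "g' y (1, 0) = (p, q)" "g' y (0, 1) = (p', q')"
      by fastforce
    let ?a = "fst (du f (g y))" and ?b = "fst (dv f (g y))"
    let ?c = "snd (du f (g y))" and ?d = "snd (dv f (g y))"
    have e: "p * ?a + q * ?b = 1" "p * ?c + q * ?d = 0" "p' * ?a + q' * ?b = 0" "p' * ?c + q' * ?d = 1"
      using expand[OF that, of "(1, 0)"] expand[OF that, of "(0, 1)"] pq by auto
    have "(p * ?a + q * ?b) * (p' * ?c + q' * ?d) - (p * ?c + q * ?d) * (p' * ?a + q' * ?b)
      = (p * q' - q * p') * J (g y)"
      by (simp add: J_def algebra_simps)
    then show False using e 0 by simp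
  qed
  have g'_eq: "g' y w = P w (g y)" if "y \<in> W" for y w
    using expand[OF that, of w] nz[OF that]
    by (cases "g' y w") (simp add: P_def J_def field_simps)
  have "Ck_on k W g" for k
  proof (induction k)
    case 0
    then show ?case
      using der by (auto intro!: continuous_at_imp_continuous_on has_derivative_continuous)
  next
    case (Suc k)
    show ?case
    proof (rule Ck_on_Suc_intro[OF der _ assms(2)])
      fix w
      have "Ck_on k W (\<lambda>y. P w (g y))"
        using P[of w] assms(4) nz
        by (intro Ck_on_compose[OF assms(2) \<open>open ?V\<close> _ _ Suc]) (auto simp: smooth_on_def)
      then show "Ck_on k W (\<lambda>y. g' y w)"
        by (rule Ck_on_cong[OF assms(2), rotated]) (simp add: g'_eq)
    qed
  qed
  then show ?thesis by (simp add: smooth_on_def)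
qed

theorem smooth_local_inverse:
  fixes f :: "real \<times> real \<Rightarrow> real \<times> real"
  assumes "open V" "a \<in> V" "smooth_on V f" "immersive_at f a"
  obtains V' W g where "open V'" "a \<in> V'" "V' \<subseteq> V" "open W" "f a \<in> W"
    "homeomorphism V' W f g" "smooth_on W g"
proof -
  define f' where "f' b = Blinfun (D f b)" for b
  have bl: "bounded_linear (D f b)" if "b \<in> V" for b
    using smooth_on_has_derivative[OF assms(3) that] has_derivative_bounded_linear by blast
  then have app: "blinfun_apply (f' b) = D f b" if "b \<in> V" for b
    using that by (simp add: f'_def bounded_linear_Blinfun_apply)
  have cont: "continuous_on V f'"
  proof (rule continuous_on_blinfun_componentwise)
    show "continuous_on V (\<lambda>b. blinfun_apply (f' b) i)" for i
      using smooth_on_continuous[OF smooth_on_D[OF assms(3), of i]]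
      by (rule continuous_on_eq) (simp add: app)
  qed
  obtain L where L: "linear L" "L \<circ> D f a = id"
    using linear_injective_left_inverse[OF bounded_linear.linear[OF bl[OF assms(2)]]] assms(4)
    by (auto simp: immersive_at_def)
  have inv: "Blinfun L o\<^sub>L f' a = id_blinfun"
    using fun_cong[OF L(2)]
    by (intro blinfun_eqI)
      (simp add: app[OF assms(2)] bounded_linear_Blinfun_apply linear_conv_bounded_linear[THEN iffD1, OF L(1)])
  have der: "(f has_derivative blinfun_apply (f' b)) (at b)" if "b \<in> V" for b
    using smooth_on_has_derivative[OF assms(3) that] by (simp add: app that)
  obtain V' W g g' where gs: "open V'" "V' \<subseteq> V" "a \<in> V'" "open W" "f a \<in> W" "homeomorphism V' W f g"
    "\<And>y. y \<in> W \<Longrightarrow> (g has_derivative g' y) (at y)"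
    "\<And>y. y \<in> W \<Longrightarrow> g' y = inv (blinfun_apply (f' (g y)))"
    "\<And>y. y \<in> W \<Longrightarrow> bij (blinfun_apply (f' (g y)))"
    using inverse_function_theorem[OF assms(1) der cont assms(2) inv] by blast
  have gW: "g ` W \<subseteq> V"
    using gs(2,6) by (auto simp: homeomorphism_def)
  have "smooth_on W g"
  proof (rule smooth_on_inverse[OF assms(1) gs(4) assms(3) gW gs(7)])
    show "D f (g y) (g' y w) = w" if "y \<in> W" for y w
    proof -
      have "g y \<in> V" using gW that by blast
      then show ?thesis
        using gs(8,9)[OF that] by (simp add: app bij_is_surj surj_f_inv_f)
    qed
  qed
  then show thesis using that gs by blast
qed

section \<open>Orthonormal frames and cross products\<close>

text \<open>
  Crossing with \<open>e2\<close> kills the component along \<open>e2\<close> and rotates the plane of \<open>e1\<close> and \<open>e3\<close> by a right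
  angle, so the Lagrange identity for \<open>(a \<times> e2) \<bullet> (b \<times> e2)\<close> yields the expansion of \<open>a \<bullet> b\<close>.
\<close>
lemma frame_inner:
  assumes "e1 \<bullet> e1 = 1" "e3 \<bullet> e3 = 1" "e1 \<bullet> e3 = 0" and e2: "e2 = cross3 e3 e1"
  shows "a \<bullet> b = (a \<bullet> e1) * (b \<bullet> e1) + (a \<bullet> e2) * (b \<bullet> e2) + (a \<bullet> e3) * (b \<bullet> e3)"
proof -
  have expand: "cross3 a e2 = (a \<bullet> e1) *\<^sub>R e3 - (a \<bullet> e3) *\<^sub>R e1" for a
    by (simp add: e2 Lagrange)
  have "e2 \<bullet> e2 = 1"
    using assms(1-3) by (simp add: e2 dot_cross inner_commute)
  moreover have "cross3 a e2 \<bullet> cross3 b e2 = (a \<bullet> e1) * (b \<bullet> e1) + (a \<bullet> e3) * (b \<bullet> e3)"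
    using assms(1-3) by (simp add: expand inner_diff_left inner_diff_right inner_commute)
  ultimately show ?thesis
    using dot_cross[of a e2 b e2] by (simp add: inner_commute[of e2 b])
qed

text \<open>
  This is the Lagrange identity for \<open>e3 = e1 \<times> (e3 \<times> e1)\<close>. When \<open>a\<close> and \<open>b\<close> are the partial derivatives of a
  map, the right-hand side is the Jacobian of its first two coordinates.
\<close>
lemma frame_cross:
  assumes "e1 \<bullet> e1 = 1" "e1 \<bullet> e3 = 0"
  shows "cross3 a b \<bullet> e3 = (a \<bullet> e1) * (b \<bullet> cross3 e3 e1) - (a \<bullet> cross3 e3 e1) * (b \<bullet> e1)"
proof -
  have "cross3 e1 (cross3 e3 e1) = e3"
    using assms by (simp add: Lagrange)
  then show ?thesis
    using dot_cross[of a b e1 "cross3 e3 e1"] by simp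
qed

lemma isometry_frame_coordinates:
  fixes q e1 e2 e3 :: "real ^ 3"
  assumes "e1 \<bullet> e1 = 1" "e3 \<bullet> e3 = 1" "e1 \<bullet> e3 = 0" "e2 = cross3 e3 e1"
  defines "T \<equiv> \<lambda>a. (vector [(a - q) \<bullet> e1, (a - q) \<bullet> e2, (a - q) \<bullet> e3] :: real ^ 3)"
  shows "dist (T a) (T b) = dist a b"
proof -
  have "T a - T b = vector [(a - b) \<bullet> e1, (a - b) \<bullet> e2, (a - b) \<bullet> e3]"
    by (simp add: T_def vec_eq_iff forall_3 vector_3 inner_diff_left)
  then have "(T a - T b) \<bullet> (T a - T b) = (a - b) \<bullet> (a - b)"
    unfolding frame_inner[OF assms(1-4), of "a - b" "a - b"]
    by (simp add: inner_vec_def[of "vector _"] sum_3 vector_3)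
  then show ?thesis
    by (simp add: dist_norm norm_eq_sqrt_inner)
qed

lemma cross_of_orthogonal_to_unit:
  fixes e a b :: "real ^ 3"
  assumes "norm e = 1" "e \<bullet> a = 0" "e \<bullet> b = 0"
  shows "cross3 a b = (e \<bullet> cross3 a b) *\<^sub>R e"
proof -
  have "cross3 e (cross3 a b) = 0"
    using assms by (simp add: Lagrange)
  then have "cross3 e (cross3 e (cross3 a b)) = 0"
    by simp
  then have "(e \<bullet> cross3 a b) *\<^sub>R e - (e \<bullet> e) *\<^sub>R cross3 a b = 0"
    unfolding Lagrange[of e e] .
  moreover have "e \<bullet> e = 1"
    using assms(1) by (simp add: norm_eq_1)
  ultimately show ?thesis
    by simp
qed

text \<open>
  By the triple product expansion, \<open>D f a (z \<bullet> f\<^sub>v, - (z \<bullet> f\<^sub>u)) = z \<times> (f\<^sub>u \<times> f\<^sub>v) = 0\<close> for every \<open>z\<close>.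
  If \<open>D f a\<close> were injective, \<open>f\<^sub>u\<close> would be orthogonal to every \<open>z\<close>.
\<close>
lemma cross_partials_zero:
  assumes "f differentiable (at a)" "cross3 (du f a) (dv f a) = 0"
  shows "\<exists>w. w \<noteq> 0 \<and> D f a w = 0"
proof (rule ccontr)
  assume "\<nexists>w. w \<noteq> 0 \<and> D f a w = 0"
  then have inj: "D f a w = 0 \<Longrightarrow> w = 0" for w
    by blast
  have "z \<bullet> du f a = 0" for z
  proof -
    have "D f a (z \<bullet> dv f a, - (z \<bullet> du f a)) = cross3 z (cross3 (du f a) (dv f a))"
      by (simp add: D_prod_eq[OF assms(1)] Lagrange)
    then show ?thesis
      using inj assms(2) by (metis cross_zero_right neg_0_equal_iff_equal snd_conv snd_zero)
  qed
  then have "D f a (1, 0) = 0"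
    by (metis du_def inner_eq_zero_iff)
  then show False
    using inj[of "(1, 0)"] by (simp add: zero_prod_def)
qed

section \<open>Normal fields and curvature\<close>

lemma normal_inner_D:
  assumes "smooth_on V x" "unit_normal_field V x n" "a \<in> V"
  shows "n a \<bullet> D x a w = 0"
  using assms(2,3) D_prod_eq[OF smooth_on_differentiable[OF assms(1,3)], of w]
  by (simp add: unit_normal_field_def inner_add_right)

lemma D_inner_eq_zero:
  fixes f g :: "'a::real_normed_vector \<Rightarrow> 'b::real_inner"
  assumes "open V" "a \<in> V" "\<And>b. b \<in> V \<Longrightarrow> f b \<bullet> g b = c"
    and "f differentiable (at a)" "g differentiable (at a)"
  shows "f a \<bullet> D g a w + D f a w \<bullet> g a = 0"
proof -
  have "((\<lambda>b. f b \<bullet> g b) has_derivative (\<lambda>w. f a \<bullet> D g a w + D f a w \<bullet> g a)) (at a)"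
    using assms(4,5) by (intro has_derivative_inner) (simp_all add: frechet_derivative_works)
  moreover have "((\<lambda>b. f b \<bullet> g b) has_derivative (\<lambda>w. 0)) (at a)"
    by (rule has_derivative_transform_within_open[OF has_derivative_const[of c] assms(1,2)])
      (simp add: assms(3))
  ultimately show ?thesis
    using has_derivative_unique by metis
qed

lemma normal_inner_D_normal:
  assumes "open V" "unit_normal_field V x n" "a \<in> V"
  shows "n a \<bullet> D n a w = 0"
proof -
  have "n differentiable (at a)"
    using assms smooth_on_differentiable by (auto simp: unit_normal_field_def)
  moreover have "n b \<bullet> n b = 1" if "b \<in> V" for b
    using assms(2) that by (simp add: unit_normal_field_def norm_eq_1)
  ultimately have "n a \<bullet> D n a w + D n a w \<bullet> n a = 0"
    using D_inner_eq_zero[OF assms(1,3)] by blast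
  then show ?thesis by (simp add: inner_commute)
qed

text \<open>
  Differentiating \<open>n \<bullet> x\<^sub>z = 0\<close> exchanges second derivatives of \<open>x\<close> for first derivatives of \<open>n\<close>.
\<close>
lemma D_normal_inner_D:
  assumes "open V" "smooth_on V x" "unit_normal_field V x n" "a \<in> V"
  shows "D n a w \<bullet> D x a z = - (n a \<bullet> D (\<lambda>b. D x b z) a w)"
proof -
  have "n a \<bullet> D (\<lambda>b. D x b z) a w + D n a w \<bullet> D x a z = 0"
  proof (rule D_inner_eq_zero[OF assms(1,4)])
    show "n b \<bullet> D x b z = 0" if "b \<in> V" for b
      using normal_inner_D[OF assms(2,3) that] .
    show "n differentiable (at a)"
      using assms(3,4) smooth_on_differentiable by (auto simp: unit_normal_field_def)
    show "(\<lambda>b. D x b z) differentiable (at a)"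
      using smooth_on_differentiable[OF smooth_on_D[OF assms(2)] assms(4)] .
  qed
  then show ?thesis by simp
qed

lemma second_fundamental_form_symmetric:
  assumes "open V" "smooth_on V x" "unit_normal_field V x n" "a \<in> V"
  shows "D n a w \<bullet> D x a z = D n a z \<bullet> D x a w"
  using D_normal_inner_D[OF assms] second_D_symmetric[OF assms(1,4,2)] by metis

text \<open>
  The smooth normal \<open>n\<close> is, at a regular point, plus or minus the normal in the definition of the
  curvature, and the sign cancels in \<open>LP - M\<^sup>2\<close>. By the Lagrange identity that determinant is the inner
  product of the two cross products, while \<open>EG - F\<^sup>2\<close> is the square of the second one.
\<close>
lemma cross_D_normal:
  assumes "open V" "smooth_on V x" "unit_normal_field V x n" "a \<in> V" "immersive_at x a"
  shows "cross3 (du n a) (dv n a) = gauss_curvature x a *\<^sub>R cross3 (du x a) (dv x a)"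
proof -
  (* C and the cross product of the partial derivatives of n are the multiples sigma and tau of n a,
     so K is tau / sigma; epsilon is the sign relating n a to the normal C / norm C. *)
  define C where "C = cross3 (du x a) (dv x a)"
  define \<sigma> where "\<sigma> = n a \<bullet> C"
  define \<tau> where "\<tau> = n a \<bullet> cross3 (du n a) (dv n a)"
  define \<epsilon> where "\<epsilon> = \<sigma> / \<bar>\<sigma>\<bar>"
  have unit: "norm (n a) = 1" "n a \<bullet> n a = 1"
    using assms(3,4) by (auto simp: unit_normal_field_def norm_eq_1)
  have C: "C = \<sigma> *\<^sub>R n a"
    unfolding C_def \<sigma>_def using assms(3,4) unit
    by (intro cross_of_orthogonal_to_unit) (auto simp: unit_normal_field_def)
  have \<tau>: "cross3 (du n a) (dv n a) = \<tau> *\<^sub>R n a"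
    unfolding \<tau>_def using normal_inner_D_normal[OF assms(1,3,4)] unit
    by (intro cross_of_orthogonal_to_unit) (auto simp: du_def dv_def)
  have diff: "x differentiable (at a)"
    using smooth_on_differentiable[OF assms(2,4)] .
  have "C \<noteq> 0"
    using cross_partials_zero[OF diff] assms(5) immersive_at_iff[OF diff] by (auto simp: C_def)
  then have "\<sigma> \<noteq> 0" using C by auto
  have N: "C /\<^sub>R norm C = \<epsilon> *\<^sub>R n a"
    using unit by (simp add: C \<epsilon>_def divide_inverse mult.commute)
  have \<epsilon>: "\<epsilon> * \<epsilon> = 1"
    using \<open>\<sigma> \<noteq> 0\<close> by (simp add: \<epsilon>_def)
  have second: "D (\<lambda>b. D x b z) a w \<bullet> (\<epsilon> *\<^sub>R n a) = - (\<epsilon> * (D n a w \<bullet> D x a z))" for w z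
    using D_normal_inner_D[OF assms(1-4), of w z] by (simp add: inner_commute)
  let ?E = "du n a \<bullet> du x a" and ?F = "du n a \<bullet> dv x a" and ?G = "dv n a \<bullet> dv x a"
  have sym: "dv n a \<bullet> du x a = ?F"
    unfolding du_def dv_def by (rule second_fundamental_form_symmetric[OF assms(1-4)])
  have "\<epsilon> * ?E * (\<epsilon> * ?G) - (\<epsilon> * ?F)\<^sup>2 = (\<epsilon> * \<epsilon>) * (?E * ?G - ?F * ?F)"
    by (simp add: power2_eq_square algebra_simps)
  also have "\<dots> = cross3 (du n a) (dv n a) \<bullet> C"
    unfolding C_def \<epsilon> by (simp add: dot_cross sym)
  also have "\<dots> = \<tau> * \<sigma>"
    using unit by (simp add: C \<tau>)
  finally have num: "\<epsilon> * ?E * (\<epsilon> * ?G) - (\<epsilon> * ?F)\<^sup>2 = \<tau> * \<sigma>" .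
  have den: "(du x a \<bullet> du x a) * (dv x a \<bullet> dv x a) - (du x a \<bullet> dv x a)\<^sup>2 = \<sigma> * \<sigma>"
  proof -
    have "C \<bullet> C = \<sigma> * \<sigma>" using unit by (simp add: C)
    then show ?thesis
      by (simp add: C_def dot_cross power2_eq_square inner_commute)
  qed
  have LMP: "du (du x) a \<bullet> (C /\<^sub>R norm C) = - (\<epsilon> * ?E)" "du (dv x) a \<bullet> (C /\<^sub>R norm C) = - (\<epsilon> * ?F)"
    "dv (dv x) a \<bullet> (C /\<^sub>R norm C) = - (\<epsilon> * ?G)"
    unfolding N du_def[abs_def] dv_def[abs_def] by (rule second)+
  have "gauss_curvature x a = \<tau> * \<sigma> / (\<sigma> * \<sigma>)"
    unfolding gauss_curvature_def Let_def C_def[symmetric] LMP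
    using num den by simp
  then show ?thesis
    using \<open>\<sigma> \<noteq> 0\<close> \<tau> C by (simp add: C_def)
qed

text \<open>
  Both sides are continuous in \<open>a\<close> and agree on the regular points, which are dense.
\<close>
lemma cross_D_normal_extended:
  assumes "open U" "V \<subseteq> U" "open V" "smooth_on V x" "unit_normal_field V x n"
    and "smooth_on U K" "U \<subseteq> closure (U - singular_set U x)"
    and K: "\<And>a. a \<in> U - singular_set U x \<Longrightarrow> K a = gauss_curvature x a"
    and "a \<in> V"
  shows "cross3 (du n a) (dv n a) = K a *\<^sub>R cross3 (du x a) (dv x a)"
proof (rule ccontr)
  define H where "H b = cross3 (du n b) (dv n b) - K b *\<^sub>R cross3 (du x b) (dv x b)" for b
  assume "\<not> ?thesis"
  then have "a \<in> {b \<in> V. H b \<noteq> 0}"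
    using assms(9) by (simp add: H_def)
  moreover have "smooth_on V n"
    using assms(5) by (simp add: unit_normal_field_def)
  then have "continuous_on V H"
    unfolding H_def[abs_def]
    by (intro continuous_intros continuous_on_cross smooth_on_continuous smooth_on_du smooth_on_dv
        assms(4) smooth_on_subset[OF assms(6,2)])
  then have "open {b \<in> V. H b \<noteq> 0}"
    using continuous_open_preimage[OF _ assms(3), of H "- {0}"]
      open_Compl[OF closed_singleton[of "0 :: real ^ 3"]]
    by (simp add: vimage_def Int_def)
  moreover have "a \<in> closure (U - singular_set U x)"
    using assms(2,7,9) by blast
  ultimately obtain b where b: "b \<in> V" "H b \<noteq> 0" "b \<in> U - singular_set U x"
    unfolding closure_iff_nhds_not_empty by blast
  then have "immersive_at x b"
    by (simp add: singular_set_def)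
  then show False
    using cross_D_normal[OF assms(3,4,5) b(1)] K[OF b(3)] b(2) by (simp add: H_def)
qed

section \<open>Coordinates adapted to a singularity\<close>

text \<open>
  If \<open>x\<close> had rank 0 at \<open>p\<close>, the Gauss map would be degenerate there, so \<open>(x, n)\<close> could not be an
  immersion. The rank is therefore 1. For \<open>w\<close> spanning the kernel of \<open>D x p\<close>, the vector \<open>D n p w\<close>
  is nonzero and orthogonal to \<open>n p\<close>; it is also orthogonal to the image of \<open>D x p\<close>,
  because the second fundamental form is symmetric. So its component along \<open>n p \<times> e\<close>, where \<open>e\<close> spans that
  image, is nonzero, and the second coordinate varies along \<open>w\<close> while the first one varies across it.
\<close>
lemma adapted_coordinates:
  assumes "open V" "smooth_on V x" "unit_normal_field V x n" "p \<in> V"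
    and "immersive_at (\<lambda>b. (x b, n b)) p" "\<not> immersive_at x p"
    and "cross3 (du n p) (dv n p) = k *\<^sub>R cross3 (du x p) (dv x p)"
  obtains e where "e \<bullet> e = 1" "e \<bullet> n p = 0"
    "immersive_at (\<lambda>b. ((x b - x p) \<bullet> e, - ((n b \<bullet> cross3 (n p) e) / (n b \<bullet> n p)))) p"
proof -
  have "smooth_on V n"
    using assms(3) by (simp add: unit_normal_field_def)
  note dx = smooth_on_has_derivative[OF assms(2,4)] and dn = smooth_on_has_derivative[OF this assms(4)]
  have diff: "x differentiable (at p)" "n differentiable (at p)"
    using dx dn by (auto simp: differentiable_def)
  have unit: "n p \<bullet> n p = 1"
    using assms(3,4) by (simp add: unit_normal_field_def norm_eq_1)
  have "D (\<lambda>b. (x b, n b)) p w = (D x p w, D n p w)" for w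
    by (rule D_eqI[OF has_derivative_Pair[OF dx dn]])
  moreover have "(\<lambda>b. (x b, n b)) differentiable (at p)"
    using assms(5) by (simp add: immersive_at_def)
  ultimately have "\<forall>w. (D x p w, D n p w) = 0 \<longrightarrow> w = 0"
    using assms(5) immersive_at_iff by fastforce
  then have imm: "w = 0" if "D x p w = 0" "D n p w = 0" for w
    using that by (metis zero_prod_def)
  obtain w where w: "w \<noteq> 0" "D x p w = 0"
    using assms(6) immersive_at_iff[OF diff(1)] by blast
  obtain w' where w': "D x p w' \<noteq> 0"
  proof (rule ccontr)
    assume "\<not> thesis"
    then have zero: "D x p z = 0" for z using that by blast
    then have "cross3 (du n p) (dv n p) = 0"
      using assms(7) by (simp add: du_def)
    then obtain z where "z \<noteq> 0" "D n p z = 0"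
      using cross_partials_zero[OF diff(2)] by blast
    then show False using imm zero by blast
  qed
  define e where "e = D x p w' /\<^sub>R norm (D x p w')"
  define e2 where "e2 = cross3 (n p) e"
  have e: "e \<bullet> e = 1"
    unfolding norm_eq_1[symmetric] using w' by (simp add: e_def)
  have en: "e \<bullet> n p = 0"
    using normal_inner_D[OF assms(2-4)] by (simp add: e_def inner_commute)
  have "D n p w \<bullet> D x p w' = 0"
    using second_fundamental_form_symmetric[OF assms(1-4), of w w'] w(2) by simp
  then have "D n p w \<bullet> e = 0" by (simp add: e_def)
  moreover have "D n p w \<bullet> n p = 0"
    using normal_inner_D_normal[OF assms(1,3,4)] by (simp add: inner_commute)
  ultimately have e2: "D n p w \<bullet> e2 \<noteq> 0"
    using frame_inner[OF e unit en e2_def, of "D n p w" "D n p w"] imm[OF w(2)] w(1) by auto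
  have orth: "n p \<bullet> e2 = 0"
    by (simp add: e2_def dot_cross_self)
  let ?f = "\<lambda>b. ((x b - x p) \<bullet> e, - ((n b \<bullet> e2) / (n b \<bullet> n p)))"
  have df: "(?f has_derivative (\<lambda>z. (D x p z \<bullet> e, - (D n p z \<bullet> e2)))) (at p)"
  proof (rule has_derivative_Pair)
    show "((\<lambda>b. (x b - x p) \<bullet> e) has_derivative (\<lambda>z. D x p z \<bullet> e)) (at p)"
      by (auto intro!: derivative_eq_intros dx)
    show "((\<lambda>b. - ((n b \<bullet> e2) / (n b \<bullet> n p))) has_derivative (\<lambda>z. - (D n p z \<bullet> e2))) (at p)"
      using unit orth by (auto intro!: derivative_eq_intros dn)
  qed
  have "immersive_at ?f p"
  proof -
    have "z = 0" if z: "D x p z \<bullet> e = 0" "D n p z \<bullet> e2 = 0" for z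
    proof -
      have lin: "linear (D x p)" "linear (D n p)"
        using diff linear_frechet_derivative by auto
      define d where "d = fst w * snd w' - snd w * fst w'"
      have "d \<noteq> 0"
      proof
        assume "d = 0"
        then have "fst w *\<^sub>R w' = fst w' *\<^sub>R w" "snd w *\<^sub>R w' = snd w' *\<^sub>R w"
          by (simp_all add: d_def prod_eq_iff mult.commute)
        then have "fst w *\<^sub>R D x p w' = 0" "snd w *\<^sub>R D x p w' = 0"
          using linear_cmul[OF lin(1)] w(2) by (metis scaleR_zero_right)+
        then show False using w' w(1) by (auto simp: prod_eq_iff)
      qed
      (* The coordinates of z in the basis w, w', by Cramer's rule. *)
      define \<alpha> \<beta> where "\<alpha> = (fst z * snd w' - snd z * fst w') / d"
        and "\<beta> = (fst w * snd z - snd w * fst z) / d"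
      have z_eq: "z = \<alpha> *\<^sub>R w + \<beta> *\<^sub>R w'"
        using \<open>d \<noteq> 0\<close> by (auto simp: prod_eq_iff \<alpha>_def \<beta>_def field_simps) (auto simp: d_def algebra_simps)
      have "D x p z = \<beta> *\<^sub>R D x p w'"
        by (simp add: z_eq linear_add[OF lin(1)] linear_cmul[OF lin(1)] w(2))
      moreover have "D x p w' \<bullet> e \<noteq> 0"
        using w' by (simp add: e_def)
      ultimately have "\<beta> = 0" using z(1) by simp
      then have "D n p z = \<alpha> *\<^sub>R D n p w"
        by (simp add: z_eq linear_cmul[OF lin(2)])
      then have "\<alpha> = 0" using z(2) e2 by simp
      then show "z = 0" using z_eq \<open>\<beta> = 0\<close> by simp
    qed
    moreover have "?f differentiable (at p)"
      using df by (auto simp: differentiable_def)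
    ultimately show ?thesis
      by (simp add: immersive_at_iff D_eqI[OF df] zero_prod_def)
  qed
  then show thesis
    using that[OF e en] by (simp add: e2_def)
qed

lemma cross3_linear_combination:
  "cross3 (a *\<^sub>R u + b *\<^sub>R v) (c *\<^sub>R u + d *\<^sub>R v) = (a * d - b * c) *\<^sub>R cross3 u v"
  by (simp add: cross_add_left cross_add_right cross_mult_left cross_mult_right
      cross_skew[of v u] algebra_simps)

lemma D_compose:
  assumes "g differentiable (at a)" "f differentiable (at (g a))"
  shows "D (\<lambda>b. f (g b)) a w = D f (g a) (D g a w)"
  using frechet_derivative_compose[OF assms] by (simp add: o_def)

lemma cross_partials_compose:
  fixes g :: "real \<times> real \<Rightarrow> real \<times> real"
  assumes "g differentiable (at a)" "f differentiable (at (g a))"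
  shows "cross3 (du (\<lambda>b. f (g b)) a) (dv (\<lambda>b. f (g b)) a)
    = (fst (du g a) * snd (dv g a) - snd (du g a) * fst (dv g a)) *\<^sub>R cross3 (du f (g a)) (dv f (g a))"
  unfolding du_def[of "\<lambda>b. f (g b)"] dv_def[of "\<lambda>b. f (g b)"] D_compose[OF assms]
    D_prod_eq[OF assms(2), of "D g a _"] cross3_linear_combination
  by (simp add: du_def dv_def)

lemma unit_normal_field_compose:
  fixes g :: "real \<times> real \<Rightarrow> real \<times> real"
  assumes "open V" "open B" "smooth_on V x" "unit_normal_field V x n" "smooth_on B g" "g ` B \<subseteq> V"
  shows "unit_normal_field B (\<lambda>a. x (g a)) (\<lambda>a. n (g a))"
proof -
  have n: "smooth_on V n" using assms(4) by (simp add: unit_normal_field_def)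
  have "n (g a) \<bullet> D (\<lambda>b. x (g b)) a w = 0" if "a \<in> B" for a w
  proof -
    have "g a \<in> V" using assms(6) that by blast
    then show ?thesis
      using D_compose[OF smooth_on_differentiable[OF assms(5) that] smooth_on_differentiable[OF assms(3)]]
        normal_inner_D[OF assms(3,4)] by simp
  qed
  then show ?thesis
    using smooth_on_compose[OF assms(2,1,6) n assms(5)] assms(4,6)
    by (auto simp: unit_normal_field_def du_def dv_def)
qed

section \<open>The normal form as a partial Legendre transform\<close>

text \<open>
  The two integrals are the Legendre transform \<open>h - v h\<^sub>v\<close> up to a constant: its \<open>u\<close>-derivative is
  the first integrand, and on the line \<open>u = 0\<close> its \<open>v\<close>-derivative is the second one.
\<close>
lemma normal_form_eq_Legendre_transform:
  assumes "smooth_on (ball (0, 0) r) h" "(u, v) \<in> ball (0, 0) r"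
  shows "normal_form h (u, v) = vector [u, - dv h (u, v), h (u, v) - v * dv h (u, v) - h (0, 0)]"
proof -
  let ?B = "ball (0, 0) r :: (real \<times> real) set"
  have sm: "smooth_on ?B (du h)" "smooth_on ?B (dv h)" "smooth_on ?B (du (dv h))"
      "smooth_on ?B (dv (dv h))"
    using assms(1) by (auto intro: smooth_on_du smooth_on_dv)
  have du_line: "((\<lambda>t. f (t, s)) has_vector_derivative du f (t, s)) (at t)"
    if "smooth_on ?B f" "(t, s) \<in> ?B" for f :: "real \<times> real \<Rightarrow> real" and t s
    using D_along_line[of f "(0, s)" t "(1, 0)"] smooth_on_differentiable[OF that]
    by (simp add: du_def has_real_derivative_iff_has_vector_derivative)
  have dv_line: "((\<lambda>t. f (s, t)) has_vector_derivative dv f (s, t)) (at t)"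
    if "smooth_on ?B f" "(s, t) \<in> ?B" for f :: "real \<times> real \<Rightarrow> real" and t s
    using D_along_line[of f "(s, 0)" t "(0, 1)"] smooth_on_differentiable[OF that]
    by (simp add: dv_def has_real_derivative_iff_has_vector_derivative)
  have in_ball: "(t, s) \<in> ?B" if "\<bar>t\<bar> \<le> \<bar>u\<bar>" "\<bar>s\<bar> \<le> \<bar>v\<bar>" for t s
  proof -
    have "norm (t, s) \<le> norm (u, v)"
      unfolding norm_Pair using that by (intro real_sqrt_le_mono add_mono power_mono) auto
    then show ?thesis
      using assms(2) unfolding zero_prod_def[symmetric] mem_ball_0 by (rule order_le_less_trans)
  qed
  have first: "(LBINT t=0..u. du h (t, v) - du (dv h) (t, v) * v)
      = (h (u, v) - dv h (u, v) * v) - (h (0, v) - dv h (0, v) * v)"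
  proof -
    have seg: "(t, v) \<in> ?B" if "t \<in> {min 0 u..max 0 u}" for t
      using that by (intro in_ball) auto
    have cont: "continuous_on {min 0 u..max 0 u} (\<lambda>t. f (t, v))" if "smooth_on ?B f"
      for f :: "real \<times> real \<Rightarrow> real"
      using has_vector_derivative_continuous[OF du_line[OF that seg]]
      by (intro continuous_at_imp_continuous_on) auto
    have "(LBINT t=ereal 0..ereal u. du h (t, v) - du (dv h) (t, v) * v)
        = (h (u, v) - dv h (u, v) * v) - (h (0, v) - dv h (0, v) * v)"
    proof (rule interval_integral_FTC_finite)
      show "continuous_on {min 0 u..max 0 u} (\<lambda>t. du h (t, v) - du (dv h) (t, v) * v)"
        by (intro continuous_on_diff continuous_on_mult continuous_on_const cont sm)
      fix t assume "min 0 u \<le> t" "t \<le> max 0 u"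
      then have "(t, v) \<in> ?B" using seg by simp
      then show "((\<lambda>t. h (t, v) - dv h (t, v) * v) has_vector_derivative
          du h (t, v) - du (dv h) (t, v) * v) (at t within {min 0 u..max 0 u})"
        by (intro has_vector_derivative_at_within[OF has_vector_derivative_diff]
            has_vector_derivative_mult_left du_line assms(1) sm)
    qed
    then show ?thesis by (simp add: zero_ereal_def)
  qed
  have second: "(LBINT t=0..v. - dv (dv h) (0, t) * t) = (h (0, v) - dv h (0, v) * v) - h (0, 0)"
  proof -
    have seg: "(0, t) \<in> ?B" if "t \<in> {min 0 v..max 0 v}" for t
      using that by (intro in_ball) auto
    have "(LBINT t=ereal 0..ereal v. - dv (dv h) (0, t) * t)
        = (h (0, v) - dv h (0, v) * v) - (h (0, 0) - dv h (0, 0) * 0)"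
    proof (rule interval_integral_FTC_finite)
      show "continuous_on {min 0 v..max 0 v} (\<lambda>t. - dv (dv h) (0, t) * t)"
        using has_vector_derivative_continuous[OF dv_line[OF sm(4) seg]]
        by (intro continuous_on_mult continuous_on_minus continuous_on_id
            continuous_at_imp_continuous_on) auto
      fix t assume "min 0 v \<le> t" "t \<le> max 0 v"
      then have t: "(0, t) \<in> ?B" using seg by simp
      have "((\<lambda>t. h (0, t) - dv h (0, t) * t) has_vector_derivative
          dv h (0, t) - (dv h (0, t) * 1 + dv (dv h) (0, t) * t)) (at t)"
        using dv_line[OF assms(1) t] dv_line[OF sm(2) t]
        by (intro has_vector_derivative_diff has_vector_derivative_mult has_vector_derivative_id)
      then show "((\<lambda>t. h (0, t) - dv h (0, t) * t) has_vector_derivative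
          - dv (dv h) (0, t) * t) (at t within {min 0 v..max 0 v})"
        using has_vector_derivative_at_within by force
    qed
    then show ?thesis by (simp add: zero_ereal_def)
  qed
  show ?thesis
    unfolding normal_form_def first second case_prod_conv by (simp add: algebra_simps)
qed

text \<open>
  Central projection of the unit sphere to its tangent plane at the third frame vector multiplies
  the area element by \<open>1 / n\<^sub>3\<^sup>4\<close> in the coordinates \<open>(n\<^sub>1, n\<^sub>2)\<close>.
\<close>
lemma wedge_central_projection:
  fixes n1 n2 n3 :: real
  assumes "n1\<^sup>2 + n2\<^sup>2 + n3\<^sup>2 = 1" "n3 \<noteq> 0"
    and "n1 * a1 + n2 * a2 + n3 * a3 = 0" "n1 * b1 + n2 * b2 + n3 * b3 = 0"
  shows "(a1 * n3 - n1 * a3) / (n3 * n3) * ((b2 * n3 - n2 * b3) / (n3 * n3))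
      - (b1 * n3 - n1 * b3) / (n3 * n3) * ((a2 * n3 - n2 * a3) / (n3 * n3))
      = (a1 * b2 - a2 * b1) / n3 ^ 4"
proof -
  have a3: "n3 * a3 = - (n1 * a1 + n2 * a2)" and b3: "n3 * b3 = - (n1 * b1 + n2 * b2)"
    using assms(3,4) by linarith+
  have "(a1 * n3 - n1 * a3) * (b2 * n3 - n2 * b3) - (b1 * n3 - n1 * b3) * (a2 * n3 - n2 * a3)
      = n3\<^sup>2 * (a1 * b2 - a2 * b1) - n2 * (a1 * (n3 * b3) - b1 * (n3 * a3))
        - n1 * ((n3 * a3) * b2 - (n3 * b3) * a2)"
    by (simp add: power2_eq_square algebra_simps)
  also have "\<dots> = (n1\<^sup>2 + n2\<^sup>2 + n3\<^sup>2) * (a1 * b2 - a2 * b1)"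
    unfolding a3 b3 by (simp add: power2_eq_square algebra_simps)
  finally have "(a1 * n3 - n1 * a3) * (b2 * n3 - n2 * b3) - (b1 * n3 - n1 * b3) * (a2 * n3 - n2 * a3)
      = a1 * b2 - a2 * b1"
    using assms(1) by simp
  moreover have "n3 ^ 4 = (n3 * n3) * (n3 * n3)"
    by (simp add: power4_eq_xxxx)
  ultimately show ?thesis
    by (simp add: times_divide_times_eq diff_divide_distrib[symmetric])
qed

text \<open>
  A frontal \<open>y\<close> parametrized by its first coordinate and by the slope \<open>- m\<^sub>2 / m\<^sub>3\<close> of its tangent planes.
  It is recovered from \<open>h = y\<^sub>3 - v y\<^sub>2\<close>, as \<open>dh = - (m\<^sub>1 / m\<^sub>3) du - y\<^sub>2 dv\<close> shows, and the differential
  equation compares the Jacobians of \<open>(m\<^sub>1 / m\<^sub>3, m\<^sub>2 / m\<^sub>3)\<close> and \<open>(y\<^sub>1, y\<^sub>2)\<close>.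
\<close>
lemma partial_Legendre_transform:
  fixes y m :: "real \<times> real \<Rightarrow> real ^ 3" and e1 e2 e3 :: "real ^ 3"
  assumes frame: "e1 \<bullet> e1 = 1" "e3 \<bullet> e3 = 1" "e1 \<bullet> e3 = 0" "e2 = cross3 e3 e1"
    and "0 < r" "smooth_on (ball (0, 0) r) y" "unit_normal_field (ball (0, 0) r) y m"
    and \<kappa>: "smooth_on (ball (0, 0) r) \<kappa>" "\<And>a. a \<in> ball (0, 0) r \<Longrightarrow>
        cross3 (du m a) (dv m a) = \<kappa> a *\<^sub>R cross3 (du y a) (dv y a)"
    and nz: "\<And>a. a \<in> ball (0, 0) r \<Longrightarrow> m a \<bullet> e3 \<noteq> 0"
    and coord1: "\<And>a. a \<in> ball (0, 0) r \<Longrightarrow> (y a - y (0, 0)) \<bullet> e1 = fst a"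
    and coord2: "\<And>a. a \<in> ball (0, 0) r \<Longrightarrow> - ((m a \<bullet> e2) / (m a \<bullet> e3)) = snd a"
  obtains h c where "smooth_on (ball (0, 0) r) h" "smooth_on (ball (0, 0) r) c"
    "\<And>a. a \<in> ball (0, 0) r \<Longrightarrow> du (du h) a + c a * dv (dv h) a = 0"
    "\<And>a. a \<in> ball (0, 0) r \<Longrightarrow> normal_form h a
      = vector [(y a - y (0, 0)) \<bullet> e1, (y a - y (0, 0)) \<bullet> e2, (y a - y (0, 0)) \<bullet> e3]"
proof -
  define B where "B = (ball (0, 0) r :: (real \<times> real) set)"
  note assms = assms[folded B_def] and that = that[folded B_def]
  note \<kappa> = \<kappa>[folded B_def] and nz = nz[folded B_def] and coord1 = coord1[folded B_def]
    and coord2 = coord2[folded B_def]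
  have B: "open B" "(0, 0) \<in> B"
    using assms(5) by (auto simp: B_def)
  define X where "X e a = (y a - y (0, 0)) \<bullet> e" for e a
  define h where "h a = X e3 a - snd a * X e2 a" for a
  define c where "c a = \<kappa> a / (m a \<bullet> e3) ^ 4" for a
  have sm: "smooth_on B y" "smooth_on B m"
    using assms(6,7) by (auto simp: unit_normal_field_def)
  have X: "smooth_on B (X e)" for e
    unfolding X_def[abs_def]
    by (intro smooth_on_inner_left smooth_on_diff smooth_on_const B sm)
  have "smooth_on B snd"
    using smooth_on_bounded_linear[OF B(1) bounded_linear_snd smooth_on_ident] .
  then have h: "smooth_on B h"
    unfolding h_def[abs_def] by (intro smooth_on_diff smooth_on_mult X B)
  have c: "smooth_on B c"
    unfolding c_def[abs_def]
    by (intro smooth_on_divide smooth_on_power smooth_on_inner_left B sm \<kappa>) (simp add: nz)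
  have dX: "(X e has_derivative (\<lambda>w. D y a w \<bullet> e)) (at a)" if "a \<in> B" for a e
    unfolding X_def[abs_def]
    by (auto intro!: derivative_eq_intros smooth_on_has_derivative[OF sm(1) that])
  have dm: "((\<lambda>a. m a \<bullet> e) has_derivative (\<lambda>w. D m a w \<bullet> e)) (at a)" if "a \<in> B" for a e
    by (auto intro!: derivative_eq_intros smooth_on_has_derivative[OF sm(2) that])
  have dquot: "((\<lambda>a. (m a \<bullet> e) / (m a \<bullet> e3)) has_derivative (\<lambda>w.
      ((D m a w \<bullet> e) * (m a \<bullet> e3) - (m a \<bullet> e) * (D m a w \<bullet> e3)) / ((m a \<bullet> e3) * (m a \<bullet> e3)))) (at a)"
    if "a \<in> B" for a e
    by (rule has_derivative_divide'[OF dm[OF that] dm[OF that] nz[OF that]])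
  have Dy1: "D y a w \<bullet> e1 = fst w" if "a \<in> B" for a w
  proof -
    have "(X e1 has_derivative fst) (at a)"
      by (rule has_derivative_transform_within_open[OF _ B(1) that])
        (auto simp: X_def coord1 intro!: derivative_eq_intros)
    from has_derivative_unique[OF dX[OF that] this] show ?thesis
      by (rule fun_cong)
  qed
  have Dm2: "((D m a w \<bullet> e2) * (m a \<bullet> e3) - (m a \<bullet> e2) * (D m a w \<bullet> e3)) / ((m a \<bullet> e3) * (m a \<bullet> e3))
      = - snd w" if "a \<in> B" for a w
  proof -
    have "((\<lambda>a. (m a \<bullet> e2) / (m a \<bullet> e3)) has_derivative (\<lambda>w. - snd w)) (at a)"
    proof (rule has_derivative_transform_within_open[OF _ B(1) that])
      show "((\<lambda>a. - snd a) has_derivative (\<lambda>w. - snd w)) (at a)"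
        by (auto intro!: derivative_eq_intros)
      show "- snd b = (m b \<bullet> e2) / (m b \<bullet> e3)" if "b \<in> B" for b
        using coord2[OF that] by simp
    qed
    from has_derivative_unique[OF dquot[OF that] this] show ?thesis
      by (rule fun_cong)
  qed
  (* The equation dy3 = v dy2 - (m1 / m3) du of the tangent planes. *)
  have Dy3: "D y a w \<bullet> e3 = snd a * (D y a w \<bullet> e2) - (m a \<bullet> e1) / (m a \<bullet> e3) * fst w"
    if "a \<in> B" for a w
  proof -
    have "(m a \<bullet> e1) * fst w + (m a \<bullet> e2) * (D y a w \<bullet> e2) + (m a \<bullet> e3) * (D y a w \<bullet> e3) = 0"
      using normal_inner_D[OF sm(1) assms(7) that, of w] Dy1[OF that, of w]
        frame_inner[OF frame, of "m a" "D y a w"] by simp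
    moreover have "m a \<bullet> e2 = - snd a * (m a \<bullet> e3)"
      using coord2[OF that] nz[OF that] by (simp add: field_simps)
    ultimately show ?thesis
      using nz[OF that] by (simp add: field_simps)
  qed
  have dh: "(h has_derivative (\<lambda>w. - ((m a \<bullet> e1) / (m a \<bullet> e3)) * fst w - X e2 a * snd w)) (at a)"
    if "a \<in> B" for a
  proof -
    have "(h has_derivative (\<lambda>w. D y a w \<bullet> e3 - (snd a * (D y a w \<bullet> e2) + snd w * X e2 a))) (at a)"
      unfolding h_def[abs_def]
      by (intro has_derivative_diff has_derivative_mult dX that has_derivative_snd has_derivative_ident)
    then show ?thesis
      by (rule has_derivative_eq_rhs) (simp add: Dy3[OF that] fun_eq_iff)
  qed
  have du_h: "- ((m a \<bullet> e1) / (m a \<bullet> e3)) = du h a" and dv_h: "- X e2 a = dv h a" if "a \<in> B" for a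
    using D_eqI[OF dh[OF that]] by (simp_all add: du_def dv_def)
  have du_du_h: "du (du h) a = - (((D m a (1, 0) \<bullet> e1) * (m a \<bullet> e3) - (m a \<bullet> e1) * (D m a (1, 0) \<bullet> e3))
      / ((m a \<bullet> e3) * (m a \<bullet> e3)))" if "a \<in> B" for a
    unfolding du_def[of "du h"]
    by (rule D_eqI) (rule has_derivative_transform_within_open
        [OF has_derivative_minus[OF dquot[OF that]] B(1) that du_h])
  have dv_dv_h: "dv (dv h) a = - (D y a (0, 1) \<bullet> e2)" if "a \<in> B" for a
    unfolding dv_def[of "dv h"]
    by (rule D_eqI) (rule has_derivative_transform_within_open
        [OF has_derivative_minus[OF dX[OF that]] B(1) that dv_h])
  have pde: "du (du h) a + c a * dv (dv h) a = 0" if "a \<in> B" for a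
  proof -
    have "m a \<bullet> m a = 1"
      using assms(7) that by (simp add: unit_normal_field_def norm_eq_1)
    then have unit: "(m a \<bullet> e1)\<^sup>2 + (m a \<bullet> e2)\<^sup>2 + (m a \<bullet> e3)\<^sup>2 = 1"
      using frame_inner[OF frame, of "m a" "m a"] by (simp add: power2_eq_square)
    have tangent: "(m a \<bullet> e1) * (D m a w \<bullet> e1) + (m a \<bullet> e2) * (D m a w \<bullet> e2)
        + (m a \<bullet> e3) * (D m a w \<bullet> e3) = 0" for w
      using normal_inner_D_normal[OF B(1) assms(7) that, of w] frame_inner[OF frame, of "m a" "D m a w"]
      by simp
    have "du (du h) a = ((D m a (1, 0) \<bullet> e1) * (D m a (0, 1) \<bullet> e2)
        - (D m a (1, 0) \<bullet> e2) * (D m a (0, 1) \<bullet> e1)) / (m a \<bullet> e3) ^ 4"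
      using wedge_central_projection[OF unit nz[OF that] tangent[of "(1, 0)"] tangent[of "(0, 1)"]]
      unfolding Dm2[OF that] du_du_h[OF that] by simp
    also have "\<dots> = (cross3 (du m a) (dv m a) \<bullet> e3) / (m a \<bullet> e3) ^ 4"
      unfolding frame_cross[OF frame(1,3)] frame(4) du_def dv_def ..
    also have "\<dots> = \<kappa> a * (cross3 (du y a) (dv y a) \<bullet> e3) / (m a \<bullet> e3) ^ 4"
      by (simp add: \<kappa>(2)[OF that])
    also have "\<dots> = \<kappa> a * (D y a (0, 1) \<bullet> e2) / (m a \<bullet> e3) ^ 4"
      unfolding frame_cross[OF frame(1,3)] du_def dv_def Dy1[OF that] by (simp add: frame(4))
    finally show ?thesis
      by (simp add: c_def dv_dv_h[OF that])
  qed
  have nf: "normal_form h a = vector [X e1 a, X e2 a, X e3 a]" if "a \<in> B" for a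
  proof -
    obtain u v where a: "a = (u, v)" by fastforce
    have "h (0, 0) = 0"
      by (simp add: h_def X_def)
    moreover have "normal_form h (u, v) = vector [u, - dv h (u, v), h (u, v) - v * dv h (u, v) - h (0, 0)]"
      using normal_form_eq_Legendre_transform h that unfolding a B_def by blast
    moreover have "X e1 (u, v) = u"
      using coord1[OF that] by (simp add: X_def a)
    moreover have "h (u, v) = X e3 (u, v) - v * X e2 (u, v)"
      by (simp add: h_def)
    ultimately show ?thesis
      using dv_h[OF that, symmetric] by (simp add: a)
  qed
  show thesis
    by (rule that[OF h c]) (simp_all add: pde nf X_def)
qed

section \<open>Wavefronts with extendable Gaussian curvature\<close>

theorem corollary4p3:
  fixes U :: "(real \<times> real) set" and x :: "real \<times> real \<Rightarrow> real ^ 3" and p :: "real \<times> real"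
  assumes "open U"
    and "wavefront U x"
    and "extendable_gauss_curvature U x"
    and "p \<in> singular_set U x"
  shows "\<exists>(T :: real ^ 3 \<Rightarrow> real ^ 3) (r :: real)
            (h :: real \<times> real \<Rightarrow> real) (c :: real \<times> real \<Rightarrow> real).
           (\<forall>a b. dist (T a) (T b) = dist a b) \<and>
           0 < r \<and>
           smooth_on (ball (0, 0) r) h \<and>
           smooth_on (ball (0, 0) r) c \<and>
           (\<forall>a \<in> ball (0, 0) r. du (du h) a + c a * dv (dv h) a = 0) \<and>
           R_equivalent (T \<circ> x) U p (normal_form h) (ball (0, 0) r) (0, 0)"
proof -
  have p: "p \<in> U" "\<not> immersive_at x p"
    using assms(4) by (auto simp: singular_set_def)
  obtain V0 n where V0: "open V0" "p \<in> V0" "V0 \<subseteq> U" "unit_normal_field V0 x n"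
    "immersive_at (\<lambda>b. (x b, n b)) p"
    using assms(2) p(1) unfolding wavefront_def by metis
  obtain K where K: "smooth_on U K" "U \<subseteq> closure (U - singular_set U x)"
    "\<And>a. a \<in> U - singular_set U x \<Longrightarrow> K a = gauss_curvature x a"
    using assms(3) unfolding extendable_gauss_curvature_def by blast
  have x0: "smooth_on V0 x"
    using assms(2) V0(3) smooth_on_subset unfolding wavefront_def frontal_def by blast
  have n0: "smooth_on V0 n"
    using V0(4) by (simp add: unit_normal_field_def)
  have curv: "cross3 (du n a) (dv n a) = K a *\<^sub>R cross3 (du x a) (dv x a)" if "a \<in> V0" for a
    by (rule cross_D_normal_extended[OF assms(1) V0(3,1) x0 V0(4) K(1,2) _ that]) (rule K(3))
  obtain e1 where e1: "e1 \<bullet> e1 = 1" "e1 \<bullet> n p = 0"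
    and imm: "immersive_at (\<lambda>b. ((x b - x p) \<bullet> e1, - ((n b \<bullet> cross3 (n p) e1) / (n b \<bullet> n p)))) p"
    by (rule adapted_coordinates[OF V0(1) x0 V0(4,2,5) p(2) curv[OF V0(2)]])
  define e2 where "e2 = cross3 (n p) e1"
  have e3: "n p \<bullet> n p = 1"
    using V0(2,4) by (simp add: unit_normal_field_def norm_eq_1)
  define f where "f b = ((x b - x p) \<bullet> e1, - ((n b \<bullet> e2) / (n b \<bullet> n p)))" for b
  define V where "V = {b \<in> V0. n b \<bullet> n p \<noteq> 0}"
  have V: "open V" "p \<in> V" "V \<subseteq> V0"
  proof -
    have "continuous_on V0 (\<lambda>b. n b \<bullet> n p)"
      by (intro smooth_on_continuous smooth_on_inner_left V0(1) n0)
    from continuous_open_preimage[OF this V0(1), of "- {0}"] show "open V"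
      by (simp add: V_def vimage_def Int_def open_Compl)
  qed (use V0(2) e3 in \<open>auto simp: V_def\<close>)
  have x: "smooth_on V x" and n: "smooth_on V n" and unf: "unit_normal_field V x n"
    using x0 n0 V0(4) V(3) smooth_on_subset unfolding unit_normal_field_def by blast+
  have f: "smooth_on V f"
    unfolding f_def[abs_def]
    by (intro smooth_on_Pair smooth_on_inner_left smooth_on_diff smooth_on_minus smooth_on_divide
        smooth_on_const V(1) x n) (simp add: V_def)
  obtain V' W g where V': "open V'" "p \<in> V'" "V' \<subseteq> V" "open W" "f p \<in> W"
    and hom: "homeomorphism V' W f g" and g: "smooth_on W g"
    using smooth_local_inverse[OF V(1,2) f] imm unfolding f_def[abs_def] e2_def by blast
  have fp: "f p = (0, 0)"
    by (simp add: f_def e2_def dot_cross_self)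
  then obtain r where r: "0 < r" "ball (0, 0) r \<subseteq> W"
    using V'(4,5) by (metis open_contains_ball)
  let ?B = "ball (0, 0) r :: (real \<times> real) set"
  have gW: "g a \<in> V'" "f (g a) = a" if "a \<in> W" for a
    using hom that by (auto simp: homeomorphism_def)
  have gB: "g ` ?B \<subseteq> V" using gW r(2) V'(3) by blast
  have g0: "g (0, 0) = p"
    using hom V'(2) fp by (metis homeomorphism_apply1)
  have g_smooth: "smooth_on ?B g"
    using g r(2) by (rule smooth_on_subset)
  (* The wavefront and its normal in the coordinates (u, v). *)
  define y where "y a = x (g a)" for a
  define m where "m a = n (g a)" for a
  have fg: "((y a - y (0, 0)) \<bullet> e1, - ((m a \<bullet> e2) / (m a \<bullet> n p))) = a" if "a \<in> ?B" for a
    using gW(2)[of a] r(2) that by (auto simp: f_def y_def m_def g0)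
  have KV: "smooth_on V K"
    using K(1) V(3) V0(3) smooth_on_subset by blast
  have y: "smooth_on ?B y" and \<kappa>: "smooth_on ?B (\<lambda>a. K (g a))"
    unfolding y_def[abs_def]
    using smooth_on_compose[OF open_ball V(1) gB _ g_smooth] x KV by blast+
  have ym: "unit_normal_field ?B y m"
    unfolding y_def[abs_def] m_def[abs_def]
    by (rule unit_normal_field_compose[OF V(1) open_ball x unf g_smooth gB])
  have curv_y: "cross3 (du m a) (dv m a) = K (g a) *\<^sub>R cross3 (du y a) (dv y a)" if "a \<in> ?B" for a
  proof -
    have "g a \<in> V" using gB that by blast
    note d = smooth_on_differentiable[OF g_smooth that] smooth_on_differentiable[OF n this]
      smooth_on_differentiable[OF x this]
    show ?thesis
      unfolding y_def[abs_def] m_def[abs_def] cross_partials_compose[OF d(1,2)]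
        cross_partials_compose[OF d(1,3)]
      using curv[of "g a"] V(3) \<open>g a \<in> V\<close> by (auto simp: mult.commute)
  qed
  obtain h c where hc: "smooth_on ?B h" "smooth_on ?B c"
    "\<And>a. a \<in> ?B \<Longrightarrow> du (du h) a + c a * dv (dv h) a = 0"
    "\<And>a. a \<in> ?B \<Longrightarrow> normal_form h a
      = vector [(y a - y (0, 0)) \<bullet> e1, (y a - y (0, 0)) \<bullet> e2, (y a - y (0, 0)) \<bullet> n p]"
  proof (rule partial_Legendre_transform[OF e1(1) e3 e1(2) e2_def r(1) y ym \<kappa>])
    show "cross3 (du m a) (dv m a) = K (g a) *\<^sub>R cross3 (du y a) (dv y a)" if "a \<in> ?B" for a
      using curv_y[OF that] .
    show "m a \<bullet> n p \<noteq> 0" if "a \<in> ?B" for a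
    proof -
      have "g a \<in> V" using gB that by blast
      then show ?thesis by (simp add: m_def V_def)
    qed
    show "(y a - y (0, 0)) \<bullet> e1 = fst a" "- ((m a \<bullet> e2) / (m a \<bullet> n p)) = snd a" if "a \<in> ?B" for a
      using fg[OF that] by (metis fst_conv, metis snd_conv)
  qed blast
  define T :: "real ^ 3 \<Rightarrow> real ^ 3"
    where "T a = vector [(a - x p) \<bullet> e1, (a - x p) \<bullet> e2, (a - x p) \<bullet> n p]" for a
  have inj: "inj_on g ?B"
    using gW(2) r(2) by (metis inj_onI subsetD)
  have gB_eq: "g ` ?B = V' \<inter> f -` ?B"
  proof
    show "g ` ?B \<subseteq> V' \<inter> f -` ?B" using gW r(2) by auto
    show "V' \<inter> f -` ?B \<subseteq> g ` ?B"
    proof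
      fix b assume "b \<in> V' \<inter> f -` ?B"
      then have "b = g (f b)" "f b \<in> ?B"
        using homeomorphism_apply1[OF hom] by auto
      then show "b \<in> g ` ?B" by (rule image_eqI)
    qed
  qed
  have open_gB: "open (g ` ?B)"
    unfolding gB_eq
    by (rule continuous_open_preimage[OF continuous_on_subset[OF smooth_on_continuous[OF f] V'(3)]
          V'(1) open_ball])
  have "smooth_on (g ` ?B) (inv_into ?B g)"
  proof (rule smooth_on_cong[OF open_gB])
    show "smooth_on (g ` ?B) f" using f gB by (rule smooth_on_subset)
    show "f b = inv_into ?B g b" if b: "b \<in> g ` ?B" for b
    proof -
      obtain a where "a \<in> ?B" "b = g a" using b by blast
      then show ?thesis
        using gW(2)[of a] r(2) inv_into_f_f[OF inj] by auto
    qed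
  qed
  then have diffeo: "diffeo_between ?B (g ` ?B) g"
    using inj g_smooth by (simp add: diffeo_between_def bij_betw_def)
  have "normal_form h a = (T \<circ> x) (g a)" if "a \<in> ?B" for a
    by (simp add: hc(4)[OF that] T_def y_def g0)
  moreover have "p \<in> g ` ?B" "g ` ?B \<subseteq> U"
    using imageI[of "(0, 0)" ?B g] g0 r(1) gB V(3) V0(3) by auto
  ultimately have "R_equivalent (T \<circ> x) U p (normal_form h) ?B (0, 0)"
    unfolding R_equivalent_def using open_gB diffeo g0 r(1)
    by (intro exI[of _ "g ` ?B"] exI[of _ ?B] exI[of _ g]) auto
  moreover have "dist (T a) (T b) = dist a b" for a b
    unfolding T_def by (rule isometry_frame_coordinates[OF e1(1) e3 e1(2) e2_def])
  ultimately show ?thesis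
    using r(1) hc(1-3) by blast
qed

end
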